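(* Given two boundary distributions $\mu_0,\mu_1\in\mathbb{P}(\mathcal{X}\times\mathcal{V})$, optimal acceleration transport (OAT) admits an optimal coupling $\pi^\ast\in\Pi(\mu_0,\mu_1)$ for the static problem $$\min_{\pi\in\Pi(\mu_0,\mu_1)}\ \mathbb{E}_{(z_0,z_1)\sim\pi}\Big[12\Big\|\frac{x_1-x_0}{T}-\frac{v_1+v_0}{2}\Big\|^2+\|v_1-v_0\|^2\Big],\qquad z_0=(x_0,v_0),\ z_1=(x_1,v_1),\ T=1.$$ For every $(x_0,v_0),(x_1,v_1)\sim\pi^\ast$, the corresponding trajectory is straight if and only if $v_0$ and $v_1$ are collinear with $x_1-x_0$. Otherwise, it bends exactly to match the endpoints' orthogonal components.
   Context: $\mathcal{X}\subset\mathbb{R}^d$ is the sample space and $\mathcal{V}\subset\mathbb{R}^d$ the velocity space (by default $\mathcal{V}=\mathbb{R}^d$). $\mathbb{P}(\mathcal{X}\times\mathcal{V})$ is the set of probability measures on $\mathcal{X}\times\mathcal{V}$, and $\Pi(\mu_0,\mu_1)$ is the set of couplings with marginals $\mu_0$ and $\mu_1$. $T>0$ denotes the time horizon between $\mu_0$ and $\mu_1$, taken equal to $1$. The trajectory corresponding to a pair $(x_0,v_0),(x_1,v_1)$ is the minimizer of $\frac12\int_0^1\|\ddot x(t)\|^2\,dt$ among twice differentiable trajectories $x:[0,1]\to\mathbb{R}^d$ with $x(0)=x_0$, $\dot x(0)=v_0$, $x(1)=x_1$, $\dot x(1)=v_1$, i.e. the coordinate-wise cubic interpolation of these data. A trajectory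 is straight if there are a unit vector $u\in\mathbb{R}^d$ and a scalar function $s$ with $x(t)=x_0+s(t)u$ for all $t\in[0,1]$. The endpoints' orthogonal components are the components of the endpoint data $(x_0,v_0)$, $(x_1,v_1)$ perpendicular to the direction $x_1-x_0$. *)

theory Defs
  imports "HOL-Probability.Probability"
begin

text \<open>Points of phase space are pairs \<open>z = (x, v)\<close> of a position and a velocity.\<close>

definition probs_on :: "('a::topological_space) set \<Rightarrow> 'a measure set" where
  "probs_on S = {M. prob_space M \<and> sets M = sets (restrict_space borel S)}"

definition couplings :: "'a measure \<Rightarrow> 'b measure \<Rightarrow> ('a \<times> 'b) measure set" where
  "couplings M N = {\<pi>. prob_space \<pi> \<and> sets \<pi> = sets (M \<Otimes>\<^sub>M N)
     \<and> distr \<pi> M fst = M \<and> distr \<pi> N snd = N}"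

definition oat_cost :: "real \<Rightarrow> ('a::euclidean_space) \<times> 'a \<Rightarrow> 'a \<times> 'a \<Rightarrow> real" where
  "oat_cost T = (\<lambda>(x0, v0) (x1, v1).
     12 * (norm ((x1 - x0) /\<^sub>R T - (v1 + v0) /\<^sub>R 2))\<^sup>2 + (norm (v1 - v0))\<^sup>2)"

text \<open>The cost is nonnegative, so its expectation always exists in \<open>[0, \<infinity>]\<close>; no moment condition
  on the marginals is imposed.\<close>

definition oat_objective ::
    "real \<Rightarrow> (('a::euclidean_space \<times> 'a) \<times> ('a \<times> 'a)) measure \<Rightarrow> ennreal" where
  "oat_objective T \<pi> = (\<integral>\<^sup>+ (z0, z1). ennreal (oat_cost T z0 z1) \<partial>\<pi>)"

definition optimal_coupling :: "real \<Rightarrow> ('a::euclidean_space \<times> 'a) measure \<Rightarrow> ('a \<times> 'a) measure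
    \<Rightarrow> (('a \<times> 'a) \<times> ('a \<times> 'a)) measure \<Rightarrow> bool" where
  "optimal_coupling T \<mu>0 \<mu>1 \<pi> \<longleftrightarrow> is_arg_min (oat_objective T) (\<lambda>\<rho>. \<rho> \<in> couplings \<mu>0 \<mu>1) \<pi>"

text \<open>The topological support, relative to the space of the measure.\<close>

definition measure_support :: "('a::topological_space) measure \<Rightarrow> 'a set" where
  "measure_support M = {z \<in> space M. \<forall>U. open U \<and> z \<in> U \<longrightarrow> emeasure M (U \<inter> space M) > 0}"

text \<open>Derivatives are one-sided at the endpoints; the values of a path outside \<open>{0..1}\<close> play no role.\<close>

definition velocity :: "(real \<Rightarrow> 'a::euclidean_space) \<Rightarrow> real \<Rightarrow> 'a" where
  "velocity x t = vector_derivative x (at t within {0..1})"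

definition acceleration :: "(real \<Rightarrow> 'a::euclidean_space) \<Rightarrow> real \<Rightarrow> 'a" where
  "acceleration x = velocity (velocity x)"

definition admissible_path ::
    "('a::euclidean_space) \<times> 'a \<Rightarrow> 'a \<times> 'a \<Rightarrow> (real \<Rightarrow> 'a) \<Rightarrow> bool" where
  "admissible_path z0 z1 x \<longleftrightarrow>
     x differentiable_on {0..1} \<and> velocity x differentiable_on {0..1} \<and>
     (x 0, velocity x 0) = z0 \<and> (x 1, velocity x 1) = z1"

definition acceleration_energy :: "(real \<Rightarrow> 'a::euclidean_space) \<Rightarrow> ennreal" where
  "acceleration_energy x = (\<integral>\<^sup>+ t\<in>{0..1}. ennreal ((norm (acceleration x t))\<^sup>2) \<partial>lborel) / 2"

definition acceleration_minimizer ::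
    "('a::euclidean_space) \<times> 'a \<Rightarrow> 'a \<times> 'a \<Rightarrow> (real \<Rightarrow> 'a) \<Rightarrow> bool" where
  "acceleration_minimizer z0 z1 x \<longleftrightarrow> is_arg_min acceleration_energy (admissible_path z0 z1) x"

text \<open>The minimizer is unique as a function on \<open>{0..1}\<close>; \<open>extensional\<close> fixes the irrelevant values
  elsewhere.\<close>

definition trajectory :: "('a::euclidean_space) \<times> 'a \<Rightarrow> 'a \<times> 'a \<Rightarrow> real \<Rightarrow> 'a" where
  "trajectory z0 z1 = (THE x. x \<in> extensional {0..1} \<and> acceleration_minimizer z0 z1 x)"

definition straight :: "(real \<Rightarrow> 'a::euclidean_space) \<Rightarrow> bool" where
  "straight x \<longleftrightarrow> (\<exists>u s. norm u = 1 \<and> (\<forall>t\<in>{0..1}. x t = x 0 + s t *\<^sub>R u))"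

text \<open>The component of \<open>w\<close> perpendicular to \<open>e\<close>; for \<open>e = 0\<close> it is all of \<open>w\<close>.\<close>

definition orth_component :: "'a::euclidean_space \<Rightarrow> 'a \<Rightarrow> 'a" where
  "orth_component e w = w - ((w \<bullet> e) / (e \<bullet> e)) *\<^sub>R e"

text \<open>How a path from \<open>(x0, v0)\<close> to \<open>(x1, v1)\<close> bends to match the orthogonal components of its
  endpoint data, orthogonality being relative to \<open>e = x1 - x0\<close>: it leaves the direction \<open>e\<close>, and
  its perpendicular part is precisely the minimal-acceleration path interpolating the
  perpendicular parts of the endpoint data, so that its bending is determined by these alone.\<close>

definition bends_to_match_orth ::
    "('a::euclidean_space) \<times> 'a \<Rightarrow> 'a \<times> 'a \<Rightarrow> (real \<Rightarrow> 'a) \<Rightarrow> bool" where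
  "bends_to_match_orth = (\<lambda>(x0, v0) (x1, v1) x.
     let P = orth_component (x1 - x0) in
       (\<exists>t\<in>{0..1}. P (x t) \<noteq> P x0) \<and>
       acceleration_minimizer (P x0, P v0) (P x1, P v1) (\<lambda>t. P (x t)))"

end

theory Submission
  imports Defs
begin

text \<open>The transport part is a compactness argument. Encode phase space by bit sequences, each point
  being the limit of a decoding of its code. Couplings become probability measures on the Cantor space
  of interleaved codes, whose masses on cylinders converge along a subsequence; the nested-interval
  construction turns the limiting masses into a measure. Since the marginals of the couplings are
  fixed, so is the law of each code under the limit, hence the limit decodes to a coupling. The cost
  is a supremum of functions of finitely many bits, so it does not increase in the limit.

  The trajectory is the cubic Hermite interpolant: its acceleration is orthogonal to that of every
  perturbation with vanishing boundary data. Its three basis polynomials are linearly independent, so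
  the displacements from \<open>x0\<close> along the cubic span the same space as \<open>x1 - x0\<close>, \<open>v0\<close>, \<open>v1\<close>, and it commutes with linear
  projections.\<close>

section \<open>Cubic interpolation minimises acceleration\<close>

lemma velocity_eqI:
  assumes "(x has_vector_derivative D) (at t within {0..1})" and "t \<in> {0..1}"
  shows "velocity x t = D"
  using vector_derivative_within_cbox[of 0 1 t x D] assms by (simp add: velocity_def)

lemma admissible_pathD:
  assumes "admissible_path z0 z1 x" and "t \<in> {0..1}"
  shows "(x has_vector_derivative velocity x t) (at t within {0..1})"
    and "(velocity x has_vector_derivative acceleration x t) (at t within {0..1})"
  using assms
  by (auto simp: admissible_path_def differentiable_on_def velocity_def acceleration_def
      vector_derivative_works)

lemma has_vector_derivative_cong_on:
  assumes "(f has_vector_derivative D) (at t within S)" and "\<And>s. s \<in> S \<Longrightarrow> f s = g s" and "t \<in> S"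
  shows "(g has_vector_derivative D) (at t within S)"
  using has_vector_derivative_transform[of t S g f D] assms by auto

text \<open>The cubic Hermite basis, with the weights of both positions merged into one multiple of
  \<open>x1 - x0\<close>; only displacement and velocities carry nonconstant weights.\<close>

definition hermite :: "('a::euclidean_space) \<times> 'a \<Rightarrow> 'a \<times> 'a \<Rightarrow> real \<Rightarrow> 'a" where
  "hermite = (\<lambda>(x0, v0) (x1, v1) t.
     x0 + (3 * t^2 - 2 * t^3) *\<^sub>R (x1 - x0) + (t^3 - 2 * t^2 + t) *\<^sub>R v0 + (t^3 - t^2) *\<^sub>R v1)"

lemma hermite_has_vector_derivative:
  "(hermite (x0, v0) (x1, v1) has_vector_derivative
     (6 * t - 6 * t^2) *\<^sub>R (x1 - x0) + (3 * t^2 - 4 * t + 1) *\<^sub>R v0 + (3 * t^2 - 2 * t) *\<^sub>R v1)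
     (at t within S)"
  unfolding hermite_def
  by (auto intro!: derivative_eq_intros simp: has_vector_derivative_def fun_eq_iff algebra_simps)

lemma hermite_velocity_has_vector_derivative:
  fixes x0 :: "'a::euclidean_space"
  shows "((\<lambda>t. (6 * t - 6 * t^2) *\<^sub>R (x1 - x0) + (3 * t^2 - 4 * t + 1) *\<^sub>R v0 + (3 * t^2 - 2 * t) *\<^sub>R v1)
     has_vector_derivative
     (6 - 12 * t) *\<^sub>R (x1 - x0) + (6 * t - 4) *\<^sub>R v0 + (6 * t - 2) *\<^sub>R v1) (at t within S)"
  by (auto intro!: derivative_eq_intros simp: has_vector_derivative_def fun_eq_iff algebra_simps)

text \<open>Lets \<open>velocity\<close> and \<open>acceleration\<close> be read off from explicit
  derivatives. Since \<open>velocity x\<close> agrees with \<open>v\<close> only on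
  \<open>{0..1}\<close>, the second derivative is transferred by congruence on that
  interval.\<close>

lemma path_derivatives:
  assumes x: "\<And>t. t \<in> {0..1} \<Longrightarrow> (x has_vector_derivative v t) (at t within {0..1})"
    and v: "\<And>t. t \<in> {0..1} \<Longrightarrow> (v has_vector_derivative a t) (at t within {0..1})"
  shows "t \<in> {0..1} \<Longrightarrow> velocity x t = v t" "t \<in> {0..1} \<Longrightarrow> acceleration x t = a t"
    "admissible_path (x 0, v 0) (x 1, v 1) x"
proof -
  show vel: "velocity x t = v t" if "t \<in> {0..1}" for t
    by (rule velocity_eqI[OF x[OF that] that])
  have acc: "(velocity x has_vector_derivative a t) (at t within {0..1})" if "t \<in> {0..1}" for t
    by (rule has_vector_derivative_cong_on[OF v[OF that] _ that]) (rule vel[symmetric])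
  show "acceleration x t = a t" if "t \<in> {0..1}" for t
    unfolding acceleration_def by (rule velocity_eqI[OF acc[OF that] that])
  show "admissible_path (x 0, v 0) (x 1, v 1) x"
  proof -
    have "x differentiable_on {0..1}" "velocity x differentiable_on {0..1}"
      unfolding differentiable_on_def using x acc differentiableI_vector by blast+
    then show ?thesis
      using vel[of 0] vel[of 1] by (simp add: admissible_path_def)
  qed
qed

lemma acceleration_energy_has_integral:
  fixes x :: "real \<Rightarrow> 'a::euclidean_space"
  assumes "((\<lambda>t. (norm (acceleration x t))\<^sup>2) has_integral I) {0..1}"
  shows "acceleration_energy x = ennreal I / 2"
proof -
  have "(\<integral>\<^sup>+ t\<in>{0..1}. ennreal ((norm (acceleration x t))\<^sup>2) \<partial>lborel)
      = (\<integral>\<^sup>+ t. ennreal (indicator {0..1} t * (norm (acceleration x t))\<^sup>2) \<partial>lborel)"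
    by (intro nn_integral_cong) (auto simp: indicator_def)
  also have "\<dots> = ennreal I"
    using nn_integral_has_integral_lebesgue[OF _ assms] by simp
  finally show ?thesis
    by (simp add: acceleration_energy_def)
qed

text \<open>The acceleration of an admissible path is a derivative, hence gauge integrable but
  possibly not Lebesgue integrable. Gauge integrability already yields Lebesgue measurability, and
  finite energy then makes the squared norm integrable.\<close>

lemma acceleration_energy_finite_integrable:
  fixes x :: "real \<Rightarrow> 'a::euclidean_space"
  assumes "acceleration x integrable_on {0..1}" and "acceleration_energy x < \<infinity>"
  shows "(\<lambda>t. (norm (acceleration x t))\<^sup>2) integrable_on {0..1}"
proof -
  let ?g = "\<lambda>t. (norm (indicator {0..1} t *\<^sub>R acceleration x t))\<^sup>2"
  obtain J where "(acceleration x has_integral J) {0..1}"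
    using assms(1) by auto
  then have "(\<lambda>t. indicator {0..1} t *\<^sub>R acceleration x t) \<in> borel_measurable lebesgue"
    by (rule has_integral_implies_lebesgue_measurable)
  then have meas: "?g \<in> borel_measurable lebesgue"
    by measurable
  \<comment> \<open>The energy is an integral over \<open>lborel\<close>, while measurability is
    known only for \<open>lebesgue\<close>; completing a measure leaves nonnegative integrals
    unchanged.\<close>
  have "(\<integral>\<^sup>+ t. ennreal (?g t) \<partial>lebesgue) = (\<integral>\<^sup>+ t\<in>{0..1}. ennreal ((norm (acceleration x t))\<^sup>2) \<partial>lborel)"
    unfolding nn_integral_completion
    by (intro nn_integral_cong) (auto simp: indicator_def)
  also have "\<dots> < \<infinity>"
    using assms(2) by (auto simp: acceleration_energy_def less_top[symmetric] ennreal_divide_eq_top_iff)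
  finally obtain r where "(\<integral>\<^sup>+ t. ennreal (?g t) \<partial>lebesgue) = ennreal r" "0 \<le> r"
    by (cases "\<integral>\<^sup>+ t. ennreal (?g t) \<partial>lebesgue" rule: ennreal_cases) auto
  with meas have "(?g has_integral r) UNIV"
    by (subst has_integral_iff_nn_integral_lebesgue) auto
  moreover have "?g = (\<lambda>t. if t \<in> {0..1} then (norm (acceleration x t))\<^sup>2 else 0)"
    by (auto simp: indicator_def fun_eq_iff)
  ultimately have "((\<lambda>t. (norm (acceleration x t))\<^sup>2) has_integral r) {0..1}"
    by (simp only: has_integral_restrict_UNIV)
  then show ?thesis by (rule has_integral_integrable)
qed

text \<open>Weighted AM-GM, \<open>norm (a s) \<le> (c + (norm (a s))\<^sup>2 / c) / 2\<close>, bounds the increments of a path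
  by \<open>c / 2\<close> for every \<open>c > 0\<close>.\<close>

lemma zero_energy_constant:
  fixes v a :: "real \<Rightarrow> 'a::euclidean_space"
  assumes v: "\<And>t. t \<in> {0..1} \<Longrightarrow> (v has_vector_derivative a t) (at t within {0..1})"
    and a: "((\<lambda>t. (norm (a t))\<^sup>2) has_integral 0) {0..1}" and t: "t \<in> {0..1}"
  shows "v t = v 0"
proof -
  have int: "(a has_integral (v t - v 0)) {0..t}"
    using t by (intro fundamental_theorem_of_calculus has_vector_derivative_within_subset[OF v]) auto
  have sub: "(\<lambda>s. (norm (a s))\<^sup>2) integrable_on {0..t}"
    using has_integral_integrable[OF a] by (rule integrable_subinterval_real) (use t in auto)
  have le: "integral {0..t} (\<lambda>s. (norm (a s))\<^sup>2) \<le> 0"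
    using integral_subset_le[OF _ sub has_integral_integrable[OF a]] t integral_unique[OF a] by simp
  have "norm (v t - v 0) \<le> c" if c: "c > 0" for c :: real
  proof -
    have amgm: "norm (a s) \<le> (c + (norm (a s))\<^sup>2 / c) / 2" for s
    proof -
      have "0 \<le> (norm (a s) - c)\<^sup>2" by simp
      then have "2 * c * norm (a s) \<le> c\<^sup>2 + (norm (a s))\<^sup>2"
        by (simp add: power2_diff algebra_simps)
      then show ?thesis using c by (simp add: field_simps power2_eq_square)
    qed
    have I: "((\<lambda>s. (c + (norm (a s))\<^sup>2 / c) / 2) has_integral
        (c * t + integral {0..t} (\<lambda>s. (norm (a s))\<^sup>2) / c) / 2) {0..t}"
      using sub t has_integral_const_real[of c 0 t]
      by (intro has_integral_divide has_integral_add) (auto simp: algebra_simps)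
    have "norm (integral {0..t} a) \<le> integral {0..t} (\<lambda>s. (c + (norm (a s))\<^sup>2 / c) / 2)"
      using int I amgm by (intro integral_norm_bound_integral) auto
    then have "norm (v t - v 0) \<le> (c * t + integral {0..t} (\<lambda>s. (norm (a s))\<^sup>2) / c) / 2"
      unfolding integral_unique[OF int] integral_unique[OF I] .
    also have "\<dots> \<le> c * t / 2"
      using divide_nonpos_pos[OF le c] by argo
    also have "\<dots> \<le> c"
    proof -
      have "c * t \<le> c * 1" using t c by (intro mult_left_mono) auto
      then show ?thesis using c by argo
    qed
    finally show ?thesis .
  qed
  then have "norm (v t - v 0) \<le> 0"
    by (rule dense_ge)
  then show ?thesis by simp
qed

lemma hermite_path:
  fixes x0 v0 x1 v1 :: "'a::euclidean_space"
  defines "a \<equiv> \<lambda>t. (6 - 12 * t) *\<^sub>R (x1 - x0) + (6 * t - 4) *\<^sub>R v0 + (6 * t - 2) *\<^sub>R v1"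
  shows "admissible_path (x0, v0) (x1, v1) (hermite (x0, v0) (x1, v1))"
    and "t \<in> {0..1} \<Longrightarrow> acceleration (hermite (x0, v0) (x1, v1)) t = a t"
proof -
  note h = path_derivatives[of "hermite (x0, v0) (x1, v1)", OF hermite_has_vector_derivative
      hermite_velocity_has_vector_derivative]
  show "admissible_path (x0, v0) (x1, v1) (hermite (x0, v0) (x1, v1))"
    using h(3) by (simp add: hermite_def)
  show "t \<in> {0..1} \<Longrightarrow> acceleration (hermite (x0, v0) (x1, v1)) t = a t"
    unfolding a_def by (rule h(2))
qed

text \<open>The acceleration of the cubic is affine, so integrating by parts twice makes it orthogonal to
  the acceleration of every perturbation \<open>h\<close> that vanishes to first order at both endpoints.\<close>

lemma hermite_orthogonal:
  fixes x0 v0 x1 v1 :: "'a::euclidean_space"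
  assumes y: "admissible_path (x0, v0) (x1, v1) y"
  defines "x \<equiv> hermite (x0, v0) (x1, v1)"
  shows "((\<lambda>t. acceleration x t \<bullet> (acceleration y t - acceleration x t)) has_integral 0) {0..1}"
proof -
  have x: "admissible_path (x0, v0) (x1, v1) x"
    unfolding x_def by (rule hermite_path)
  let ?a = "\<lambda>t. (6 - 12 * t) *\<^sub>R (x1 - x0) + (6 * t - 4) *\<^sub>R v0 + (6 * t - 2) *\<^sub>R v1"
  let ?q = "(- 12) *\<^sub>R (x1 - x0) + 6 *\<^sub>R v0 + 6 *\<^sub>R v1"
  let ?h = "\<lambda>t. y t - x t" and ?k = "\<lambda>t. velocity y t - velocity x t"
  have a: "(?a has_vector_derivative ?q) (at t within {0..1})" for t
    by (auto intro!: derivative_eq_intros simp: has_vector_derivative_def fun_eq_iff algebra_simps)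
  have "((\<lambda>t. ?a t \<bullet> ?k t - ?q \<bullet> ?h t) has_vector_derivative
      acceleration x t \<bullet> (acceleration y t - acceleration x t)) (at t within {0..1})"
    if t: "t \<in> {0..1}" for t
  proof -
    have h: "(?h has_vector_derivative ?k t) (at t within {0..1})"
      using admissible_pathD(1)[OF y t] admissible_pathD(1)[OF x t]
      by (rule has_vector_derivative_diff)
    have k: "(?k has_vector_derivative acceleration y t - acceleration x t) (at t within {0..1})"
      using admissible_pathD(2)[OF y t] admissible_pathD(2)[OF x t]
      by (rule has_vector_derivative_diff)
    have "((\<lambda>t. ?a t \<bullet> ?k t) has_vector_derivative
        ?a t \<bullet> (acceleration y t - acceleration x t) + ?q \<bullet> ?k t) (at t within {0..1})"
      by (rule bounded_bilinear.has_vector_derivative[OF bounded_bilinear_inner a k])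
    moreover have "((\<lambda>t. ?q \<bullet> ?h t) has_vector_derivative ?q \<bullet> ?k t) (at t within {0..1})"
      by (rule bounded_linear.has_vector_derivative[OF bounded_linear_inner_right h])
    ultimately have "((\<lambda>t. ?a t \<bullet> ?k t - ?q \<bullet> ?h t) has_vector_derivative
        (?a t \<bullet> (acceleration y t - acceleration x t) + ?q \<bullet> ?k t) - ?q \<bullet> ?k t) (at t within {0..1})"
      by (rule has_vector_derivative_diff)
    then show ?thesis
      using hermite_path(2)[OF t, of x0 v0 x1 v1] unfolding x_def by simp
  qed
  \<comment> \<open>The antiderivative vanishes at 0 and 1, where both paths share position and
    velocity.\<close>
  from fundamental_theorem_of_calculus[OF _ this] show ?thesis
    using x y by (simp add: admissible_path_def)
qed

text \<open>Pythagoras: by orthogonality the energy of \<open>y\<close> exceeds that of the cubic by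
  half the integral of the squared acceleration difference. Equality makes this integral zero, and
  integrating up twice, first for velocities and then for positions, identifies the paths.\<close>

lemma hermite_minimal:
  fixes x0 v0 x1 v1 :: "'a::euclidean_space"
  assumes y: "admissible_path (x0, v0) (x1, v1) y"
  defines "x \<equiv> hermite (x0, v0) (x1, v1)"
  shows "acceleration_energy x \<le> acceleration_energy y"
    and "acceleration_energy y \<le> acceleration_energy x \<Longrightarrow> t \<in> {0..1} \<Longrightarrow> y t = x t"
proof -
  have x: "admissible_path (x0, v0) (x1, v1) x"
    unfolding x_def by (rule hermite_path)
  let ?k = "\<lambda>t. velocity y t - velocity x t"
  let ?b = "\<lambda>t. acceleration y t - acceleration x t"
  have k: "(?k has_vector_derivative ?b t) (at t within {0..1})" if t: "t \<in> {0..1}" for t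
    using admissible_pathD(2)[OF y t] admissible_pathD(2)[OF x t] by (rule has_vector_derivative_diff)
  have h: "((\<lambda>t. y t - x t) has_vector_derivative ?k t) (at t within {0..1})" if t: "t \<in> {0..1}" for t
    using admissible_pathD(1)[OF y t] admissible_pathD(1)[OF x t] by (rule has_vector_derivative_diff)
  have orth: "((\<lambda>t. acceleration x t \<bullet> ?b t) has_integral 0) {0..1}"
    unfolding x_def by (rule hermite_orthogonal[OF y])
  have "(\<lambda>t. (norm (acceleration x t))\<^sup>2) integrable_on {0..1}"
  proof -
    have "(\<lambda>t. (norm ((6 - 12 * t) *\<^sub>R (x1 - x0) + (6 * t - 4) *\<^sub>R v0 + (6 * t - 2) *\<^sub>R v1))\<^sup>2)
        integrable_on {0..1}"
      by (intro integrable_continuous_real continuous_intros)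
    then show ?thesis
    proof (rule integrable_eq)
      fix t :: real assume "t \<in> {0..1}"
      from hermite_path(2)[OF this, of x0 v0 x1 v1] show
        "(norm ((6 - 12 * t) *\<^sub>R (x1 - x0) + (6 * t - 4) *\<^sub>R v0 + (6 * t - 2) *\<^sub>R v1))\<^sup>2
          = (norm (acceleration x t))\<^sup>2"
        unfolding x_def by (rule arg_cong[OF sym])
    qed
  qed
  then obtain I where I: "((\<lambda>t. (norm (acceleration x t))\<^sup>2) has_integral I) {0..1}"
    by auto
  then have I0: "I \<ge> 0"
    by (rule has_integral_nonneg) simp
  have Ex: "acceleration_energy x = ennreal I / 2"
    by (rule acceleration_energy_has_integral[OF I])
  \<comment> \<open>Competitors of infinite energy are trivially no better, so the energies are
    expanded only where the squared acceleration is integrable.\<close>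
  have main: "\<exists>K\<ge>0. acceleration_energy y = ennreal (I + K) / 2 \<and>
      ((\<lambda>t. (norm (?b t))\<^sup>2) has_integral K) {0..1}" if fin: "acceleration_energy y < \<infinity>"
  proof -
    have "(acceleration y has_integral (velocity y 1 - velocity y 0)) {0..1}"
      using admissible_pathD(2)[OF y] by (intro fundamental_theorem_of_calculus) auto
    then have "(\<lambda>t. (norm (acceleration y t))\<^sup>2) integrable_on {0..1}"
      using fin by (intro acceleration_energy_finite_integrable) auto
    then obtain J where J: "((\<lambda>t. (norm (acceleration y t))\<^sup>2) has_integral J) {0..1}"
      by auto
    have "((\<lambda>t. (norm (acceleration y t))\<^sup>2 - (norm (acceleration x t))\<^sup>2
        - 2 * (acceleration x t \<bullet> ?b t)) has_integral (J - I - 2 * 0)) {0..1}"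
      by (intro has_integral_diff J I has_integral_mult_right orth)
    moreover have "(norm (acceleration y t))\<^sup>2 - (norm (acceleration x t))\<^sup>2
        - 2 * (acceleration x t \<bullet> ?b t) = (norm (?b t))\<^sup>2" for t
      by (simp add: power2_norm_eq_inner inner_diff_left inner_diff_right inner_commute)
    ultimately have K: "((\<lambda>t. (norm (?b t))\<^sup>2) has_integral (J - I)) {0..1}"
      by simp
    moreover have "J - I \<ge> 0"
      using K by (rule has_integral_nonneg) simp
    ultimately show ?thesis
      using acceleration_energy_has_integral[OF J] by (intro exI[of _ "J - I"]) auto
  qed
  show "acceleration_energy x \<le> acceleration_energy y"
  proof (cases "acceleration_energy y < \<infinity>")
    case True
    with main obtain K where "K \<ge> 0" "acceleration_energy y = ennreal (I + K) / 2" by blast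
    with I0 show ?thesis
      unfolding Ex by (auto intro!: divide_right_mono_ennreal ennreal_leI)
  qed (simp add: not_less top_unique)
  show "y t = x t" if le: "acceleration_energy y \<le> acceleration_energy x" and t: "t \<in> {0..1}"
  proof -
    have "acceleration_energy x < \<infinity>"
      unfolding Ex by (simp add: ennreal_divide_eq_top_iff less_top[symmetric])
    with le main obtain K where K: "K \<ge> 0" "acceleration_energy y = ennreal (I + K) / 2"
      and bK: "((\<lambda>t. (norm (?b t))\<^sup>2) has_integral K) {0..1}"
      by (meson le_less_trans)
    have "ennreal ((I + K) / 2) \<le> ennreal (I / 2)"
      using le K I0 unfolding Ex by (simp add: divide_ennreal[symmetric])
    with K I0 have "K = 0"
      by simp
    with bK have zero: "((\<lambda>t. (norm (?b t))\<^sup>2) has_integral 0) {0..1}" by simp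
    have k0: "?k s = 0" if "s \<in> {0..1}" for s
      using zero_energy_constant[OF k zero that] x y by (simp add: admissible_path_def)
    have "y t - x t = y 0 - x 0"
    proof (rule zero_energy_constant[of _ ?k, OF h _ t])
      show "((\<lambda>s. (norm (?k s))\<^sup>2) has_integral 0) {0..1}"
        by (rule has_integral_is_0) (simp only: k0 norm_zero zero_power2)
    qed
    then show ?thesis
      using x y by (simp add: admissible_path_def)
  qed
qed

lemma velocity_cong:
  assumes "\<And>s. s \<in> {0..1} \<Longrightarrow> f s = g s" and "t \<in> {0..1}"
  shows "velocity f t = velocity g t"
proof -
  have "(f has_vector_derivative D) (at t within {0..1}) \<longleftrightarrow>
      (g has_vector_derivative D) (at t within {0..1})" for D
    using assms has_vector_derivative_cong_on[of f D t "{0..1}" g]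
      has_vector_derivative_cong_on[of g D t "{0..1}" f] by auto
  then show ?thesis
    by (simp add: velocity_def vector_derivative_def)
qed

text \<open>Admissibility and energy see only the values on \<open>{0..1}\<close>. Allowing any
  \<open>x\<close> that agrees there with the cubic serves both the extensional trajectory and its
  projection, whose values outside differ.\<close>

lemma hermite_restrict_minimizer:
  fixes x0 v0 x1 v1 :: "'a::euclidean_space"
  assumes eq: "\<And>t. t \<in> {0..1} \<Longrightarrow> x t = hermite (x0, v0) (x1, v1) t"
  shows "acceleration_minimizer (x0, v0) (x1, v1) x"
proof -
  let ?h = "hermite (x0, v0) (x1, v1)"
  have vel: "velocity x t = velocity ?h t" if "t \<in> {0..1}" for t
    using eq that by (rule velocity_cong)
  have acc: "acceleration x t = acceleration ?h t" if "t \<in> {0..1}" for t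
    unfolding acceleration_def using vel that by (rule velocity_cong)
  have adm: "admissible_path (x0, v0) (x1, v1) ?h"
    by (rule hermite_path)
  have "(x has_vector_derivative velocity ?h t) (at t within {0..1})"
    "(velocity ?h has_vector_derivative acceleration ?h t) (at t within {0..1})" if "t \<in> {0..1}" for t
    using has_vector_derivative_cong_on[OF admissible_pathD(1)[OF adm that], of x]
      admissible_pathD(2)[OF adm that] eq that by auto
  from path_derivatives(3)[OF this]
  have "admissible_path (x0, v0) (x1, v1) x"
    using adm eq[of 0] eq[of 1] by (simp add: admissible_path_def)
  moreover have "acceleration_energy x = acceleration_energy ?h"
    unfolding acceleration_energy_def
    by (intro arg_cong[where f = "\<lambda>u. u / 2"] nn_integral_cong) (auto simp: indicator_def acc)
  ultimately show ?thesis
    using hermite_minimal(1)[of x0 v0 x1 v1]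
    by (auto simp: acceleration_minimizer_def is_arg_min_def not_less)
qed

text \<open>Uniqueness is the equality case of \<open>hermite_minimal\<close>; extensionality
  settles the values outside the interval.\<close>

lemma trajectory_eq_hermite:
  fixes x0 v0 x1 v1 :: "'a::euclidean_space"
  shows "trajectory (x0, v0) (x1, v1) = restrict (hermite (x0, v0) (x1, v1)) {0..1}"
  unfolding trajectory_def
proof (rule the_equality)
  show "restrict (hermite (x0, v0) (x1, v1)) {0..1} \<in> extensional {0..1} \<and>
      acceleration_minimizer (x0, v0) (x1, v1) (restrict (hermite (x0, v0) (x1, v1)) {0..1})"
    using hermite_restrict_minimizer[of "restrict (hermite (x0, v0) (x1, v1)) {0..1}" x0 v0 x1 v1]
    by simp
next
  fix y assume y: "y \<in> extensional {0..1} \<and> acceleration_minimizer (x0, v0) (x1, v1) y"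
  then have adm: "admissible_path (x0, v0) (x1, v1) y"
    and "acceleration_energy y \<le> acceleration_energy (hermite (x0, v0) (x1, v1))"
    using hermite_path(1)[of x0 v0 x1 v1]
    by (auto simp: acceleration_minimizer_def is_arg_min_def not_less)
  then have "y t = hermite (x0, v0) (x1, v1) t" if "t \<in> {0..1}" for t
    using hermite_minimal(2)[OF adm] that by auto
  with y show "y = restrict (hermite (x0, v0) (x1, v1)) {0..1}"
    by (intro extensionalityI[of _ "{0..1}"]) auto
qed

section \<open>Geometry of the trajectory\<close>

text \<open>Modulo \<open>x1 - x0\<close>, the values at 1/3 and 2/3 are two independent
  combinations of \<open>v0\<close> and \<open>v1\<close>, so these points suffice to recover the
  data.\<close>

lemma hermite_points:
  fixes x0 v0 x1 v1 :: "'a::euclidean_space"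
  defines "x \<equiv> hermite (x0, v0) (x1, v1)"
  shows "x 0 = x0" "x 1 = x1"
    and "x (1/3) - x0 = (7/27) *\<^sub>R (x1 - x0) + (4/27) *\<^sub>R v0 - (2/27) *\<^sub>R v1"
    and "x (2/3) - x0 = (20/27) *\<^sub>R (x1 - x0) + (2/27) *\<^sub>R v0 - (4/27) *\<^sub>R v1"
  by (simp_all add: x_def hermite_def power2_eq_square power3_eq_cube scaleR_left_diff_distrib[symmetric])

lemma hermite_data_in_span:
  fixes x0 v0 x1 v1 :: "'a::euclidean_space"
  assumes S: "subspace S" and in_S: "\<And>t. t \<in> {0..1} \<Longrightarrow> hermite (x0, v0) (x1, v1) t - x0 \<in> S"
  shows "x1 - x0 \<in> S" "v0 \<in> S" "v1 \<in> S"
proof -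
  show e: "x1 - x0 \<in> S"
    using in_S[of 1] by (simp add: hermite_points)
  let ?p = "(7/27) *\<^sub>R (x1 - x0) + (4/27) *\<^sub>R v0 - (2/27) *\<^sub>R v1"
  let ?q = "(20/27) *\<^sub>R (x1 - x0) + (2/27) *\<^sub>R v0 - (4/27) *\<^sub>R v1"
  have p: "?p \<in> S" and q: "?q \<in> S"
    using in_S[of "1/3"] in_S[of "2/3"] by (simp_all add: hermite_points)
  \<comment> \<open>The coefficients solve the linear system given by \<open>?p\<close> and
    \<open>?q\<close>; \<open>v1\<close> is eliminated first.\<close>
  have "v0 = 9 *\<^sub>R ?p - (9/2) *\<^sub>R ?q + 1 *\<^sub>R (x1 - x0)"
    by (rule euclidean_eqI) (simp add: inner_add_left inner_diff_left field_simps)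
  also have "\<dots> \<in> S"
    by (intro subspace_add subspace_diff subspace_scale S p q e)
  finally show v0: "v0 \<in> S" .
  have "v1 = (7/2) *\<^sub>R (x1 - x0) + 2 *\<^sub>R v0 - (27/2) *\<^sub>R ?p"
    by (rule euclidean_eqI) (simp add: inner_add_left inner_diff_left field_simps)
  also have "\<dots> \<in> S"
    by (intro subspace_add subspace_diff subspace_scale S p v0 e)
  finally show "v1 \<in> S" .
qed

lemma hermite_mem_subspace:
  fixes x0 v0 x1 v1 :: "'a::euclidean_space"
  assumes "subspace S" "x1 - x0 \<in> S" "v0 \<in> S" "v1 \<in> S"
  shows "hermite (x0, v0) (x1, v1) t - x0 \<in> S"
proof -
  have "hermite (x0, v0) (x1, v1) t - x0 =
      (3 * t^2 - 2 * t^3) *\<^sub>R (x1 - x0) + (t^3 - 2 * t^2 + t) *\<^sub>R v0 + (t^3 - t^2) *\<^sub>R v1"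
    by (simp add: hermite_def)
  also have "\<dots> \<in> S"
    using assms by (intro subspace_add subspace_scale) auto
  finally show ?thesis .
qed

text \<open>A line containing the origin is the span of its direction. Normalising that direction
  matches the unit vector demanded by \<open>straight\<close>.\<close>

lemma collinear_with_0_iff:
  fixes A :: "'a::euclidean_space set"
  shows "collinear (insert 0 A) \<longleftrightarrow> (\<exists>u. norm u = 1 \<and> A \<subseteq> span {u})"
proof
  assume "collinear (insert 0 A)"
  then obtain u where u: "\<forall>x\<in>insert 0 A. \<forall>y\<in>insert 0 A. \<exists>c. x - y = c *\<^sub>R u"
    unfolding collinear_def by blast
  have A: "A \<subseteq> span {u}"
  proof
    fix y assume "y \<in> A"
    with u obtain c where "y - 0 = c *\<^sub>R u" by blast
    then show "y \<in> span {u}" by (simp add: span_mul span_base)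
  qed
  show "\<exists>u. norm u = 1 \<and> A \<subseteq> span {u}"
  proof (cases "u = 0")
    \<comment> \<open>Here \<open>A\<close> contains at most the origin, so any unit vector
      serves.\<close>
    case True
    obtain b :: 'a where "b \<in> Basis" using nonempty_Basis by blast
    moreover have "A \<subseteq> span {b}"
      using A True by (auto simp: span_zero)
    ultimately show ?thesis by (metis norm_Basis)
  next
    case False
    then have "u = norm u *\<^sub>R (u /\<^sub>R norm u)" by simp
    then have "u \<in> span {u /\<^sub>R norm u}"
      by (metis span_base span_mul singletonI)
    then have "span {u} \<subseteq> span {u /\<^sub>R norm u}"
      by (simp add: span_minimal)
    with A False show ?thesis
      by (intro exI[of _ "u /\<^sub>R norm u"]) auto
  qed
next
  assume "\<exists>u. norm u = 1 \<and> A \<subseteq> span {u}"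
  then obtain u where "A \<subseteq> span {u}" by blast
  then have "insert 0 A \<subseteq> span {u}" by (simp add: span_zero)
  then have "\<exists>c. x - y = c *\<^sub>R u" if "x \<in> insert 0 A" "y \<in> insert 0 A" for x y
    using that span_diff[of x "{u}" y] by (auto simp: span_singleton)
  then show "collinear (insert 0 A)"
    unfolding collinear_def by blast
qed

text \<open>For fixed \<open>u\<close>, the displacements stay in \<open>span {u}\<close> exactly
  when the three data vectors do. This includes \<open>x1 = x0\<close>, where the condition says
  that \<open>v0\<close> and \<open>v1\<close> are parallel.\<close>

lemma straight_trajectory_iff:
  fixes x0 v0 x1 v1 :: "'a::euclidean_space"
  shows "straight (trajectory (x0, v0) (x1, v1)) \<longleftrightarrow> collinear {0, x1 - x0, v0, v1}"
proof -
  let ?h = "hermite (x0, v0) (x1, v1)"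
  have mem: "?h t - x0 \<in> span {u} \<longleftrightarrow> (\<exists>c. ?h t = x0 + c *\<^sub>R u)" for t u
    by (auto simp: span_singleton image_iff diff_eq_eq add.commute)
  \<comment> \<open>Choice collects the pointwise coefficients into the scalar function
    \<open>s\<close>.\<close>
  have line: "(\<exists>s. \<forall>t\<in>{0..1}. ?h t = x0 + s t *\<^sub>R u) \<longleftrightarrow> (\<forall>t\<in>{0..1}. ?h t - x0 \<in> span {u})" for u
    unfolding mem by (rule bchoice_iff[symmetric])
  have sub: "(\<forall>t\<in>{0..1}. ?h t - x0 \<in> span {u}) \<longleftrightarrow> {x1 - x0, v0, v1} \<subseteq> span {u}" for u
  proof
    assume "\<forall>t\<in>{0..1}. ?h t - x0 \<in> span {u}"
    then show "{x1 - x0, v0, v1} \<subseteq> span {u}"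
      by (intro insert_subsetI hermite_data_in_span[of "span {u}" x0 v0 x1 v1] empty_subsetI) auto
  next
    assume "{x1 - x0, v0, v1} \<subseteq> span {u}"
    then show "\<forall>t\<in>{0..1}. ?h t - x0 \<in> span {u}"
      by (intro ballI hermite_mem_subspace) auto
  qed
  have "straight (trajectory (x0, v0) (x1, v1)) \<longleftrightarrow>
      (\<exists>u. norm u = 1 \<and> (\<exists>s. \<forall>t\<in>{0..1}. ?h t = x0 + s t *\<^sub>R u))"
    by (simp add: straight_def trajectory_eq_hermite hermite_points)
  then show ?thesis
    unfolding line sub collinear_with_0_iff .
qed

lemma linear_orth_component: "linear (orth_component e)"
  by (rule linearI) (auto simp: orth_component_def inner_add_left add_divide_distrib algebra_simps)

lemma orth_component_eq_0D: "orth_component e w = 0 \<Longrightarrow> w \<in> span {e}"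
  by (auto simp: orth_component_def span_singleton)

lemma linear_hermite:
  fixes P :: "'a::euclidean_space \<Rightarrow> 'a"
  assumes "linear P"
  shows "P (hermite (x0, v0) (x1, v1) t) = hermite (P x0, P v0) (P x1, P v1) t"
  by (simp add: hermite_def linear_add[OF assms] linear_diff[OF assms] linear_scale[OF assms])

text \<open>A linear projection maps the cubic to the cubic of the projected data, which is a
  minimizer for them. Were the projected path constant, both projected velocities would vanish,
  putting all data on one line.\<close>

lemma trajectory_bends_to_match_orth:
  fixes x0 v0 x1 v1 :: "'a::euclidean_space"
  assumes "\<not> collinear {0, x1 - x0, v0, v1}"
  shows "bends_to_match_orth (x0, v0) (x1, v1) (trajectory (x0, v0) (x1, v1))"
proof -
  let ?P = "orth_component (x1 - x0)" and ?h = "hermite (x0, v0) (x1, v1)"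
  have P: "?P (trajectory (x0, v0) (x1, v1) t) = hermite (?P x0, ?P v0) (?P x1, ?P v1) t"
    if "t \<in> {0..1}" for t
    using that by (simp add: trajectory_eq_hermite linear_hermite[OF linear_orth_component])
  have "\<exists>t\<in>{0..1}. ?P (trajectory (x0, v0) (x1, v1) t) \<noteq> ?P x0"
  proof (rule ccontr)
    assume "\<not> ?thesis"
    then have "hermite (?P x0, ?P v0) (?P x1, ?P v1) t - ?P x0 \<in> {0}" if "t \<in> {0..1}" for t
      using P that by auto
    then have "?P v0 = 0" "?P v1 = 0"
      using hermite_data_in_span[of "{0}" "?P x0" "?P v0" "?P x1" "?P v1"] by (auto simp: subspace_def)
    then have sub: "{x1 - x0, v0, v1} \<subseteq> span {x1 - x0}"
      using orth_component_eq_0D[of "x1 - x0"] by (auto simp: span_base)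
    \<comment> \<open>Provides a unit direction even when \<open>x1 = x0\<close>, where the
      projection is the identity and the span is trivial.\<close>
    have "collinear {0, x1 - x0}" by simp
    then obtain u where u: "norm u = 1" "{x1 - x0} \<subseteq> span {u}"
      unfolding collinear_with_0_iff by (elim exE conjE)
    have "span {x1 - x0} \<subseteq> span {u}"
      by (rule span_minimal[OF u(2)]) simp
    with sub u(1) have "collinear {0, x1 - x0, v0, v1}"
      unfolding collinear_with_0_iff by (intro exI[of _ u] conjI) (auto simp del: insert_subset)
    with assms show False by simp
  qed
  moreover have "acceleration_minimizer (?P x0, ?P v0) (?P x1, ?P v1)
      (\<lambda>t. ?P (trajectory (x0, v0) (x1, v1) t))"
    by (rule hermite_restrict_minimizer) (rule P)
  ultimately show ?thesis
    by (simp add: bends_to_match_orth_def Let_def)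
qed

section \<open>Probability measures on the Cantor space\<close>

abbreviation bit_space :: "(nat \<Rightarrow> bool) measure" where
  "bit_space \<equiv> Pi\<^sub>M UNIV (\<lambda>_. count_space UNIV)"

lemma space_bit_space: "space bit_space = UNIV"
  by (simp add: space_PiM)

lemma measurable_bit: "(\<lambda>f. f n) \<in> bit_space \<rightarrow>\<^sub>M count_space UNIV"
  by (rule measurable_component_singleton) simp

lemma measurable_bit_spaceI:
  assumes "\<And>n. (\<lambda>x. F x n) \<in> M \<rightarrow>\<^sub>M count_space UNIV"
  shows "F \<in> M \<rightarrow>\<^sub>M bit_space"
  using measurable_PiM_single'[of UNIV "\<lambda>n x. F x n" M "\<lambda>_. count_space UNIV"] assms
  by (simp add: PiE_UNIV_domain)

lemma measurable_bit_compose: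
  assumes "F \<in> M \<rightarrow>\<^sub>M bit_space"
  shows "(\<lambda>x. F x n) \<in> M \<rightarrow>\<^sub>M count_space UNIV"
  using measurable_compose[OF assms measurable_bit] .

section \<open>Histories and cylinder sets\<close>

primrec history :: "(nat \<Rightarrow> 'a) \<Rightarrow> nat \<Rightarrow> 'a list" where
  "history f 0 = []"
| "history f (Suc n) = f n # history f n"

lemma length_history [simp]: "length (history f n) = n"
  by (induction n) auto

lemma history_eq_iff: "history f n = history g n \<longleftrightarrow> (\<forall>i<n. f i = g i)"
  by (induction n) (auto simp: less_Suc_eq)

lemma sets_history_eq: "{f. history f n = h} \<in> sets bit_space"
proof (induction n arbitrary: h)
  case 0
  then show ?case using sets.top[of bit_space] by (cases h) (auto simp: space_bit_space)
next
  case (Suc n)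
  show ?case
  proof (cases h)
    case Nil
    then show ?thesis by simp
  next
    case (Cons b h')
    have "{f. f n = b} \<in> sets bit_space"
      using measurable_sets[OF measurable_bit, of "{b}" n] by (simp add: space_bit_space vimage_def)
    moreover have "{f. history f (Suc n) = h} = {f. f n = b} \<inter> {f. history f n = h'}"
      using Cons by auto
    ultimately show ?thesis
      using Suc by auto
  qed
qed

text \<open>Sets depending on the first \<open>n\<close> coordinates only. For bits these are finite
  disjoint unions of cylinders, so their masses are finite sums of history masses.\<close>

definition finitary :: "nat \<Rightarrow> (nat \<Rightarrow> 'a) set \<Rightarrow> bool" where
  "finitary n C \<longleftrightarrow> (\<forall>f g. (\<forall>i<n. f i = g i) \<longrightarrow> f \<in> C \<longleftrightarrow> g \<in> C)"

lemma finitary_history_eq: "finitary n {f. history f n = h}"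
  unfolding finitary_def by (metis history_eq_iff mem_Collect_eq)

lemma finitary_eq_UN_history:
  assumes "finitary n C"
  shows "C = (\<Union>h\<in>(\<lambda>f. history f n) ` C. {f. history f n = h})"
proof (intro equalityI subsetI)
  fix f assume "f \<in> (\<Union>h\<in>(\<lambda>f. history f n) ` C. {f. history f n = h})"
  then obtain g where "g \<in> C" "history f n = history g n" by auto
  then show "f \<in> C"
    using assms unfolding finitary_def history_eq_iff by blast
qed auto

lemma finite_histories: "finite ((\<lambda>f. history f n) ` (C :: (nat \<Rightarrow> bool) set))"
  by (rule finite_subset[OF _ finite_lists_length_eq[of UNIV n]]) auto

lemma sets_finitary: "finitary n C \<Longrightarrow> C \<in> sets bit_space"
  by (subst finitary_eq_UN_history, assumption)
    (intro sets.finite_UN finite_histories sets_history_eq)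

lemma measure_finitary:
  assumes "prob_space P" "sets P = sets bit_space" "finitary n C"
  shows "measure P C = (\<Sum>h\<in>(\<lambda>f. history f n) ` C. measure P {f. history f n = h})"
proof -
  interpret prob_space P by fact
  have "measure P (\<Union>h\<in>(\<lambda>f. history f n) ` C. {f. history f n = h}) =
      (\<Sum>h\<in>(\<lambda>f. history f n) ` C. measure P {f. history f n = h})"
    by (rule finite_measure_finite_Union)
      (auto simp: finite_histories assms(2) sets_history_eq disjoint_family_on_def)
  then show ?thesis
    using finitary_eq_UN_history[OF assms(3)] by simp
qed

text \<open>A consistent family \<open>p\<close> of masses on finite histories is realised on \<open>{0..<1}\<close>: the histories of
  length \<open>n\<close> label a partition into intervals of length \<open>p h\<close>, refined at each step, and \<open>lower p h\<close>
  is the left endpoint of the interval labelled \<open>h\<close>.\<close>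

primrec lower :: "(bool list \<Rightarrow> real) \<Rightarrow> bool list \<Rightarrow> real" where
  "lower p [] = 0"
| "lower p (b # h) = lower p h + (if b then p (False # h) else 0)"

primrec digits :: "(bool list \<Rightarrow> real) \<Rightarrow> real \<Rightarrow> nat \<Rightarrow> bool list" where
  "digits p t 0 = []"
| "digits p t (Suc n) =
    (lower p (digits p t n) + p (False # digits p t n) \<le> t) # digits p t n"

text \<open>The measure is the law of the digit sequence of a uniformly distributed point.\<close>

lemma ex_bit_measure:
  assumes nonneg: "\<And>h. 0 \<le> p h" and total: "p [] = 1"
    and split: "\<And>h. p h = p (False # h) + p (True # h)"
  obtains P where "prob_space P" "sets P = sets bit_space"
    "\<And>n h. length h = n \<Longrightarrow> measure P {f. history f n = h} = p h"
proof -
  \<comment> \<open>The interval of \<open>h'\<close> is cut at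
    \<open>lower p h' + p (False # h')\<close>: the left part receives the bit \<open>False\<close>,
    the right part \<open>True\<close>.\<close>
  have digits_eq: "digits p t n = h \<longleftrightarrow> length h = n \<and> lower p h \<le> t \<and> t < lower p h + p h"
    if t: "t \<in> {0..<1}" for t n h
  proof (induction n arbitrary: h)
    case 0
    then show ?case using t total by auto
  next
    case (Suc n)
    show ?case
    proof (cases h)
      case (Cons b h')
      then show ?thesis
        using Suc[of h'] split[of h'] nonneg[of "False # h'"] nonneg[of "True # h'"] by auto
    qed auto
  qed
  have lower: "0 \<le> lower p h \<and> lower p h + p h \<le> 1" for h
  proof (induction h)
    case (Cons b h)
    then show ?case
      using split[of h] nonneg[of "False # h"] nonneg[of "True # h"] by auto
  qed (simp add: total)
  define U where "U = restrict_space lborel {0..<1::real}"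
  have spU: "space U = {0..<1}"
    by (simp add: U_def space_restrict_space)
  interpret U: prob_space U
    unfolding U_def by (rule prob_space_restrict_space) auto
  have pre: "{t\<in>{0..<1}. digits p t n = h} =
      (if length h = n then {lower p h..<lower p h + p h} else {})" for n h
    using digits_eq[of _ n h] lower[of h] by auto
  have meas_digits: "(\<lambda>t. digits p t n) \<in> U \<rightarrow>\<^sub>M count_space UNIV" for n
    unfolding measurable_count_space_eq2_countable
  proof (intro conjI ballI)
    fix h :: "bool list"
    have "(\<lambda>t. digits p t n) -` {h} \<inter> space U = {t\<in>{0..<1}. digits p t n = h}"
      by (auto simp: spU)
    also note pre
    finally have eq: "(\<lambda>t. digits p t n) -` {h} \<inter> space U =
        (if length h = n then {lower p h..<lower p h + p h} else {})" .
    have "(if length h = n then {lower p h..<lower p h + p h} else {}) \<subseteq> {0..<1}"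
      using lower[of h] by auto
    then show "(\<lambda>t. digits p t n) -` {h} \<inter> space U \<in> sets U"
      unfolding eq unfolding U_def by (subst sets_restrict_space_iff) auto
  qed simp
  \<comment> \<open>Histories list the newest bit first, so bit \<open>n\<close> is the head after
    \<open>n + 1\<close> steps.\<close>
  define F where "F t n = hd (digits p t (Suc n))" for t n
  have F: "F \<in> U \<rightarrow>\<^sub>M bit_space"
    unfolding F_def
    by (intro measurable_bit_spaceI measurable_compose[OF meas_digits]) simp
  have hist: "history (F t) n = digits p t n" for t n
    by (induction n) (auto simp: F_def)
  have "measure (distr U bit_space F) {f. history f n = h} = p h" if "length h = n" for n h
  proof -
    have "measure (distr U bit_space F) {f. history f n = h} = measure U {t\<in>{0..<1}. digits p t n = h}"
      by (subst measure_distr[OF F sets_history_eq]) (auto simp: hist spU intro!: arg_cong[where f = "measure U"])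
    also have "\<dots> = measure U {lower p h..<lower p h + p h}"
      unfolding pre using that by simp
    also have "\<dots> = measure lborel {lower p h..<lower p h + p h}"
      unfolding U_def using lower[of h] by (subst measure_restrict_space) auto
    also have "\<dots> = p h"
      using nonneg[of h] by simp
    finally show ?thesis .
  qed
  with that[of "distr U bit_space F"] U.prob_space_distr[OF F] show thesis
    by simp
qed

text \<open>The history masses are points of a countable power of the unit interval, which is
  sequentially compact. Nonnegativity, total mass and the splitting identity survive coordinatewise
  limits, so the limit is realised by a measure.\<close>

lemma bit_measures_seq_compact:
  fixes Q :: "nat \<Rightarrow> (nat \<Rightarrow> bool) measure"
  assumes prob: "\<And>k. prob_space (Q k)" and sets: "\<And>k. sets (Q k) = sets bit_space"
  obtains r P where "strict_mono r" "prob_space P" "sets P = sets bit_space"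
    "\<And>n C. finitary n C \<Longrightarrow> (\<lambda>k. measure (Q (r k)) C) \<longlonglongrightarrow> measure P C"
proof -
  define q where "q k h = measure (Q k) {f. history f (length h) = h}" for k h
  have "compact (PiE UNIV (\<lambda>_ :: bool list. {0..1::real}))"
    using compactin_PiE[of "\<lambda>_. euclidean" UNIV "\<lambda>_ :: bool list. {0..1::real}"]
    by (simp add: euclidean_product_topology)
  then have "seq_compact (PiE UNIV (\<lambda>_ :: bool list. {0..1::real}))"
    by (rule compact_imp_seq_compact)
  moreover have "q k \<in> PiE UNIV (\<lambda>_. {0..1})" for k
    using prob_space.prob_le_1[OF prob] by (auto simp: q_def)
  ultimately obtain p r where r: "strict_mono r" and lim: "(q \<circ> r) \<longlonglongrightarrow> p"
    unfolding seq_compact_def by metis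
  have coord: "continuous_on UNIV (\<lambda>f :: bool list \<Rightarrow> real. f h)" for h
    by (rule continuous_on_product_coordinates)
  have lim: "(\<lambda>k. q (r k) h) \<longlonglongrightarrow> p h" for h
    using continuous_on_tendsto_compose[OF coord lim, of h] by (simp add: o_def)
  have qsplit: "q k h = q k (False # h) + q k (True # h)" for k h
  proof -
    interpret prob_space "Q k" by (rule prob)
    have "{f. history f (length h) = h} = {f. history f (Suc (length h)) = False # h} \<union>
        {f. history f (Suc (length h)) = True # h}"
      by auto
    moreover have "prob ({f. history f (Suc (length h)) = False # h} \<union>
        {f. history f (Suc (length h)) = True # h}) =
        prob {f. history f (Suc (length h)) = False # h} + prob {f. history f (Suc (length h)) = True # h}"
      by (rule finite_measure_Union) (simp_all only: sets sets_history_eq, auto)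
    ultimately show ?thesis
      unfolding q_def length_Cons by simp
  qed
  have qtot: "q k [] = 1" for k
    using prob_space.prob_space[OF prob[of k]] sets_eq_imp_space_eq[OF sets[of k]]
    by (simp add: q_def space_bit_space)
  obtain P where P: "prob_space P" "sets P = sets bit_space"
    and Pp: "\<And>n h. length h = n \<Longrightarrow> measure P {f. history f n = h} = p h"
  proof (rule ex_bit_measure[of p])
    show "0 \<le> p h" for h
      by (rule LIMSEQ_le_const[OF lim]) (simp add: q_def)
    show "p [] = 1"
      by (rule LIMSEQ_unique[OF lim]) (simp add: qtot)
    show "p h = p (False # h) + p (True # h)" for h
      by (rule LIMSEQ_unique[OF lim]) (subst qsplit, intro tendsto_add lim)
  qed blast
  have "(\<lambda>k. measure (Q (r k)) C) \<longlonglongrightarrow> measure P C" if C: "finitary n C" for n C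
  proof -
    have "(\<lambda>k. \<Sum>h\<in>(\<lambda>f. history f n) ` C. measure (Q (r k)) {f. history f n = h})
        \<longlonglongrightarrow> (\<Sum>h\<in>(\<lambda>f. history f n) ` C. measure P {f. history f n = h})"
    proof (rule tendsto_sum)
      fix h assume "h \<in> (\<lambda>f. history f n) ` C"
      then have "length h = n" by auto
      then show "(\<lambda>k. measure (Q (r k)) {f. history f n = h}) \<longlonglongrightarrow> measure P {f. history f n = h}"
        using lim[of h] by (simp add: Pp q_def)
    qed
    then show ?thesis
      by (simp add: measure_finitary[OF prob sets C] measure_finitary[OF P C])
  qed
  with that r P show thesis by blast
qed

text \<open>A product box restricting finitely many coordinates is finitary, and such boxes
  determine a finite measure.\<close>

lemma bit_measure_eqI:
  assumes P: "prob_space P" "sets P = sets bit_space" and Q: "prob_space Q" "sets Q = sets bit_space"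
    and eq: "\<And>n C. finitary n C \<Longrightarrow> measure P C = measure Q C"
  shows "P = Q"
proof (rule measure_eqI_PiM_infinite[OF P(2) Q(2)])
  fix A :: "nat \<Rightarrow> bool set" and J :: "nat set"
  assume "finite J"
  then obtain n where n: "J \<subseteq> {..<n}"
    using finite_nat_bounded by blast
  have "finitary n (prod_emb UNIV (\<lambda>_. count_space UNIV) J (Pi\<^sub>E J A))"
    using n by (auto simp: finitary_def prod_emb_iff PiE_iff subset_eq)
  from eq[OF this] show "emeasure P (prod_emb UNIV (\<lambda>_. count_space UNIV) J (Pi\<^sub>E J A)) =
      emeasure Q (prod_emb UNIV (\<lambda>_. count_space UNIV) J (Pi\<^sub>E J A))"
    using P(1) Q(1) by (simp add: finite_measure.emeasure_eq_measure prob_space_def)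
qed (use P in \<open>simp add: prob_space_def\<close>)

section \<open>Compactness of couplings\<close>

lemma finitary_reindex: "finitary n C \<Longrightarrow> (\<And>k. k < n \<Longrightarrow> j k < m) \<Longrightarrow> finitary m {f. (\<lambda>k. f (j k)) \<in> C}"
  unfolding finitary_def by simp

lemma measurable_reindex: "(\<lambda>f k. f (j k)) \<in> bit_space \<rightarrow>\<^sub>M bit_space"
  by (intro measurable_bit_spaceI measurable_bit)

lemma couplingsD:
  assumes "\<pi> \<in> couplings M N"
  shows "prob_space \<pi>" "sets \<pi> = sets (M \<Otimes>\<^sub>M N)" "space \<pi> = space (M \<Otimes>\<^sub>M N)"
    "distr \<pi> M fst = M" "distr \<pi> N snd = N"
  using assms sets_eq_imp_space_eq[of \<pi> "M \<Otimes>\<^sub>M N"] by (auto simp: couplings_def)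

text \<open>The independent coupling ensures that the infimum of the costs is over a nonempty
  set.\<close>

lemma pair_measure_coupling:
  assumes "prob_space M" "prob_space N"
  shows "M \<Otimes>\<^sub>M N \<in> couplings M N"
proof -
  interpret M: prob_space M by fact
  interpret N: prob_space N by fact
  interpret pair_prob_space M N ..
  have "distr (M \<Otimes>\<^sub>M N) N snd = N"
  proof (rule measure_eqI)
    fix A assume "A \<in> sets (distr (M \<Otimes>\<^sub>M N) N snd)"
    then have A: "A \<in> sets N" by simp
    have "emeasure (distr (M \<Otimes>\<^sub>M N) N snd) A = emeasure (M \<Otimes>\<^sub>M N) (space M \<times> A)"
      using A sets.sets_into_space[OF A]
      by (subst emeasure_distr) (auto simp: space_pair_measure intro!: arg_cong2[where f = emeasure])
    also have "\<dots> = emeasure N A"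
      using A by (simp add: M.emeasure_pair_measure_Times N.emeasure_pair_measure_Times M.emeasure_space_1)
    finally show "emeasure (distr (M \<Otimes>\<^sub>M N) N snd) A = emeasure N A" .
  qed simp
  moreover have "distr (M \<Otimes>\<^sub>M N) M fst = M"
    by (rule N.distr_pair_fst)
  ultimately show ?thesis
    using prob_space_axioms by (simp add: couplings_def)
qed

text \<open>Even bits code the first component and odd bits the second, so both marginal codes are
  reindexings of one sequence.\<close>

definition interleave :: "('a \<Rightarrow> nat \<Rightarrow> bool) \<Rightarrow> ('b \<Rightarrow> nat \<Rightarrow> bool) \<Rightarrow> 'a \<times> 'b \<Rightarrow> nat \<Rightarrow> bool" where
  "interleave e0 e1 w k = (if even k then e0 (fst w) (k div 2) else e1 (snd w) (k div 2))"

lemma measurable_interleave: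
  assumes "e0 \<in> M \<rightarrow>\<^sub>M bit_space" "e1 \<in> N \<rightarrow>\<^sub>M bit_space"
  shows "interleave e0 e1 \<in> M \<Otimes>\<^sub>M N \<rightarrow>\<^sub>M bit_space"
proof (rule measurable_bit_spaceI)
  fix k
  have "(\<lambda>w. e0 (fst w) (k div 2)) \<in> M \<Otimes>\<^sub>M N \<rightarrow>\<^sub>M count_space UNIV"
    by (rule measurable_compose[OF measurable_fst measurable_bit_compose[OF assms(1)]])
  moreover have "(\<lambda>w. e1 (snd w) (k div 2)) \<in> M \<Otimes>\<^sub>M N \<rightarrow>\<^sub>M count_space UNIV"
    by (rule measurable_compose[OF measurable_snd measurable_bit_compose[OF assms(2)]])
  ultimately show "(\<lambda>w. interleave e0 e1 w k) \<in> M \<Otimes>\<^sub>M N \<rightarrow>\<^sub>M count_space UNIV"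
    by (cases "even k") (simp_all add: interleave_def)
qed

lemma interleave_even: "(\<lambda>k. interleave e0 e1 w (2 * k)) = e0 (fst w)"
  and interleave_odd: "(\<lambda>k. interleave e0 e1 w (2 * k + 1)) = e1 (snd w)"
  by (auto simp: interleave_def fun_eq_iff)

text \<open>The preimage of a finitary set under reindexing is again finitary. Its mass is constant
  along the sequence, hence also in the limit.\<close>

lemma weak_limit_reindex:
  assumes P: "prob_space P" "sets P = sets bit_space"
    and lim: "\<And>n C. finitary n C \<Longrightarrow> (\<lambda>k. measure (Q k) C) \<longlonglongrightarrow> measure P C"
    and Q: "\<And>k. prob_space (Q k)" "\<And>k. sets (Q k) = sets bit_space"
    and marg: "\<And>k :: nat. distr (Q k) bit_space (\<lambda>f i. f (j i)) = R"
  shows "distr P bit_space (\<lambda>f i. f (j i)) = R"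
proof (rule bit_measure_eqI)
  have mP: "(\<lambda>f i. f (j i)) \<in> P \<rightarrow>\<^sub>M bit_space"
    unfolding measurable_cong_sets[OF P(2) refl] by (rule measurable_reindex)
  have mQ: "(\<lambda>f i. f (j i)) \<in> Q k \<rightarrow>\<^sub>M bit_space" for k
    unfolding measurable_cong_sets[OF Q(2) refl] by (rule measurable_reindex)
  show "prob_space (distr P bit_space (\<lambda>f i. f (j i)))"
    by (rule prob_space.prob_space_distr[OF P(1) mP])
  show "prob_space R"
    unfolding marg[of 0, symmetric] by (rule prob_space.prob_space_distr[OF Q(1) mQ])
  show "sets R = sets bit_space"
    unfolding marg[of 0, symmetric] by simp
  fix n C assume C: "finitary n (C :: (nat \<Rightarrow> bool) set)"
  have spP: "space P = UNIV" and spQ: "space (Q k) = UNIV" for k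
    using sets_eq_imp_space_eq[OF P(2)] sets_eq_imp_space_eq[OF Q(2)[of k]]
    by (simp_all add: space_bit_space)
  have fin: "finitary (Suc (Max (j ` {..n}))) {f. (\<lambda>i. f (j i)) \<in> C}"
    by (rule finitary_reindex[OF C]) (auto simp: less_Suc_eq_le)
  have "measure (Q k) {f. (\<lambda>i. f (j i)) \<in> C} = measure R C" for k
    unfolding marg[of k, symmetric]
    by (subst measure_distr[OF mQ sets_finitary[OF C]]) (simp add: spQ vimage_def)
  with lim[OF fin] have "measure P {f. (\<lambda>i. f (j i)) \<in> C} = measure R C"
    by (simp add: LIMSEQ_const_iff)
  then show "measure (distr P bit_space (\<lambda>f i. f (j i))) C = measure R C"
    by (subst measure_distr[OF mP sets_finitary[OF C]]) (simp add: spP vimage_def)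
qed simp

text \<open>The limit measure might charge sequences that code no point. The identity holds for
  every genuine code, and \<open>F\<close> has the same law as such codes.\<close>

lemma AE_code_of_decoded:
  assumes F: "F \<in> P \<rightarrow>\<^sub>M bit_space" and law: "distr P bit_space F = distr L bit_space e"
    and e: "e \<in> L \<rightarrow>\<^sub>M bit_space" and g: "g \<in> bit_space \<rightarrow>\<^sub>M L"
    and ge: "\<And>z. z \<in> space L \<Longrightarrow> g (e z) = z"
  shows "AE f in P. e (g (F f)) i = F f i"
proof -
  have [measurable]: "Measurable.pred bit_space (\<lambda>b. e (g b) i)" "Measurable.pred bit_space (\<lambda>b. b i)"
    by (rule measurable_bit_compose[OF measurable_compose[OF g e]]) (rule measurable_bit)
  have meas: "{b \<in> space bit_space. e (g b) i = b i} \<in> sets bit_space"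
    by measurable
  have "AE z in L. e (g (e z)) i = e z i"
    using ge by (intro AE_I2) simp
  then have "AE b in distr L bit_space e. e (g b) i = b i"
    by (subst AE_distr_iff[OF e meas])
  then show ?thesis
    unfolding law[symmetric] by (subst (asm) AE_distr_iff[OF F meas])
qed

text \<open>Couplings are pushed to interleaved codes, a limit \<open>P\<close> is extracted there,
  and decoding \<open>P\<close> gives \<rho>. The fixed marginal code laws yield the marginals of
  \<rho> and make almost every sequence under \<open>P\<close> a genuine code.\<close>

lemma couplings_seq_compact:
  fixes M :: "'a measure" and N :: "'b measure"
  assumes e0: "e0 \<in> M \<rightarrow>\<^sub>M bit_space" and f0: "f0 \<in> bit_space \<rightarrow>\<^sub>M M"
    and fe0: "\<And>z. z \<in> space M \<Longrightarrow> f0 (e0 z) = z"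
    and e1: "e1 \<in> N \<rightarrow>\<^sub>M bit_space" and f1: "f1 \<in> bit_space \<rightarrow>\<^sub>M N"
    and fe1: "\<And>z. z \<in> space N \<Longrightarrow> f1 (e1 z) = z"
    and \<pi>: "\<And>k::nat. \<pi> k \<in> couplings M N"
  obtains r \<rho> where "strict_mono r" "\<rho> \<in> couplings M N"
    "\<And>n C. finitary n C \<Longrightarrow>
      (\<lambda>k. measure (\<pi> (r k)) (interleave e0 e1 -` C \<inter> space (M \<Otimes>\<^sub>M N)))
        \<longlonglongrightarrow> measure \<rho> (interleave e0 e1 -` C \<inter> space (M \<Otimes>\<^sub>M N))"
proof -
  let ?E = "interleave e0 e1"
  have E: "?E \<in> M \<Otimes>\<^sub>M N \<rightarrow>\<^sub>M bit_space"
    by (rule measurable_interleave[OF e0 e1])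
  have E\<pi>: "?E \<in> \<pi> k \<rightarrow>\<^sub>M bit_space" for k
    unfolding measurable_cong_sets[OF couplingsD(2)[OF \<pi>] refl] by (rule E)
  define Q where "Q k = distr (\<pi> k) bit_space ?E" for k
  have Q: "prob_space (Q k)" "sets (Q k) = sets bit_space" for k
    using prob_space.prob_space_distr[OF couplingsD(1)[OF \<pi>] E\<pi>] by (simp_all add: Q_def)
  obtain r P where r: "strict_mono r" and P: "prob_space P" "sets P = sets bit_space"
    and lim: "\<And>n C. finitary n C \<Longrightarrow> (\<lambda>k. measure (Q (r k)) C) \<longlonglongrightarrow> measure P C"
    using bit_measures_seq_compact[of Q, OF Q] by blast
  have fst\<pi>: "fst \<in> \<pi> k \<rightarrow>\<^sub>M M" and snd\<pi>: "snd \<in> \<pi> k \<rightarrow>\<^sub>M N" for k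
    unfolding measurable_cong_sets[OF couplingsD(2)[OF \<pi>] refl]
    by (rule measurable_fst, rule measurable_snd)
  have "distr (Q k) bit_space (\<lambda>f i. f (2 * i)) = distr M bit_space e0" for k
  proof -
    have "distr (Q k) bit_space (\<lambda>f i. f (2 * i)) = distr (\<pi> k) bit_space (e0 \<circ> fst)"
      unfolding Q_def
      by (subst distr_distr[OF measurable_reindex E\<pi>]) (simp add: o_def interleave_even)
    also have "\<dots> = distr (distr (\<pi> k) M fst) bit_space e0"
      by (rule distr_distr[OF e0 fst\<pi>, symmetric])
    finally show ?thesis unfolding couplingsD(4)[OF \<pi>] .
  qed
  then have ev: "distr P bit_space (\<lambda>f i. f (2 * i)) = distr M bit_space e0"
    by (intro weak_limit_reindex[OF P lim Q]) auto
  have "distr (Q k) bit_space (\<lambda>f i. f (2 * i + 1)) = distr N bit_space e1" for k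
  proof -
    have "distr (Q k) bit_space (\<lambda>f i. f (2 * i + 1)) = distr (\<pi> k) bit_space (e1 \<circ> snd)"
      unfolding Q_def
      by (subst distr_distr[OF measurable_reindex E\<pi>]) (simp only: o_def interleave_odd)
    also have "\<dots> = distr (distr (\<pi> k) N snd) bit_space e1"
      by (rule distr_distr[OF e1 snd\<pi>, symmetric])
    finally show ?thesis unfolding couplingsD(5)[OF \<pi>] .
  qed
  then have od: "distr P bit_space (\<lambda>f i. f (2 * i + 1)) = distr N bit_space e1"
    by (intro weak_limit_reindex[OF P lim Q]) auto
  have reP: "(\<lambda>f i. f (j i)) \<in> P \<rightarrow>\<^sub>M bit_space" for j
    unfolding measurable_cong_sets[OF P(2) refl] by (rule measurable_reindex)
  define d0 where "d0 f = f0 (\<lambda>i. f (2 * i))" for f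
  define d1 where "d1 f = f1 (\<lambda>i. f (2 * i + 1))" for f
  have d0: "d0 \<in> P \<rightarrow>\<^sub>M M" and d1: "d1 \<in> P \<rightarrow>\<^sub>M N"
    unfolding d0_def d1_def by (rule measurable_compose[OF reP f0], rule measurable_compose[OF reP f1])
  define D where "D f = (d0 f, d1 f)" for f
  have D: "D \<in> P \<rightarrow>\<^sub>M M \<Otimes>\<^sub>M N"
    unfolding D_def by (rule measurable_Pair[OF d0 d1])
  define \<rho> where "\<rho> = distr P (M \<Otimes>\<^sub>M N) D"
  have "distr \<rho> M fst = distr P M (f0 \<circ> (\<lambda>f i. f (2 * i)))"
    unfolding \<rho>_def by (subst distr_distr[OF measurable_fst D]) (simp add: o_def D_def d0_def)
  also have "\<dots> = distr M M (f0 \<circ> e0)"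
    unfolding distr_distr[OF f0 reP, symmetric] ev by (rule distr_distr[OF f0 e0])
  also have "\<dots> = M"
    using distr_cong[of M M M M "f0 \<circ> e0" "\<lambda>x. x"] fe0 by (simp add: distr_id)
  finally have m0: "distr \<rho> M fst = M" .
  have "distr \<rho> N snd = distr P N (f1 \<circ> (\<lambda>f i. f (2 * i + 1)))"
    unfolding \<rho>_def by (subst distr_distr[OF measurable_snd D]) (simp add: o_def D_def d1_def)
  also have "\<dots> = distr N N (f1 \<circ> e1)"
    unfolding distr_distr[OF f1 reP, symmetric] od by (rule distr_distr[OF f1 e1])
  also have "\<dots> = N"
    using distr_cong[of N N N N "f1 \<circ> e1" "\<lambda>x. x"] fe1 by (simp add: distr_id)
  finally have m1: "distr \<rho> N snd = N" .
  have \<rho>: "\<rho> \<in> couplings M N"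
    using m0 m1 prob_space.prob_space_distr[OF P(1) D] by (simp add: couplings_def \<rho>_def)
  have "AE f in P. \<forall>i. e0 (d0 f) i = f (2 * i) \<and> e1 (d1 f) i = f (2 * i + 1)"
    unfolding d0_def d1_def AE_all_countable
    using AE_code_of_decoded[OF reP ev e0 f0 fe0] AE_code_of_decoded[OF reP od e1 f1 fe1]
    by (auto intro: AE_conjI)
  then have "AE f in P. ?E (D f) = f"
  proof (rule AE_mp, intro AE_I2 impI ext)
    fix f k assume "\<forall>i. e0 (d0 f) i = f (2 * i) \<and> e1 (d1 f) i = f (2 * i + 1)"
    then show "?E (D f) k = f k"
      by (cases "even k") (auto simp: interleave_def D_def)
  qed
  then have "distr P bit_space (?E \<circ> D) = distr P bit_space (\<lambda>f. f)"
    using measurable_comp[OF D E] P(2) by (intro distr_cong_AE) (auto simp: o_def)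
  also have "\<dots> = P"
    using P(2) by (simp add: distr_id2)
  \<comment> \<open>Encoding \<rho> returns \<open>P\<close>, so cylinder masses of \<open>P\<close>
    are masses under \<rho> of the corresponding sets of pairs.\<close>
  finally have law: "distr \<rho> bit_space ?E = P"
    unfolding \<rho>_def by (simp add: distr_distr[OF E D])
  have E\<rho>: "?E \<in> \<rho> \<rightarrow>\<^sub>M bit_space"
    using E by (simp add: \<rho>_def)
  have "(\<lambda>k. measure (\<pi> (r k)) (?E -` C \<inter> space (M \<Otimes>\<^sub>M N)))
        \<longlonglongrightarrow> measure \<rho> (?E -` C \<inter> space (M \<Otimes>\<^sub>M N))" if C: "finitary n C" for n C
    using lim[OF C] measure_distr[OF E\<pi> sets_finitary[OF C]] measure_distr[OF E\<rho> sets_finitary[OF C]]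
    unfolding law Q_def by (simp add: couplingsD(3)[OF \<pi>] couplingsD(3)[OF \<rho>])
  with that r \<rho> show thesis by blast
qed

section \<open>Lower semicontinuity of the expected cost\<close>

text \<open>The cost is approximated from below by its infima over the finitely many sets of points whose
  first \<open>n\<close> code bits are prescribed.\<close>

lemma nn_integral_le_of_finitary_limit:
  fixes c :: "'a \<Rightarrow> ennreal"
  assumes E: "E \<in> M \<rightarrow>\<^sub>M bit_space"
    and P: "prob_space P" "sets P = sets M"
    and Q: "\<And>k. prob_space (Q k)" "\<And>k. sets (Q k) = sets M"
    and lim: "\<And>n C. finitary n C \<Longrightarrow>
      (\<lambda>k. measure (Q k) (E -` C \<inter> space M)) \<longlonglongrightarrow> measure P (E -` C \<inter> space M)"
    and fin: "\<And>w. w \<in> space M \<Longrightarrow> c w < \<infinity>"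
    and lsc: "\<And>w a. w \<in> space M \<Longrightarrow> a < c w \<Longrightarrow>
      \<exists>n. \<forall>w'\<in>space M. (\<forall>i<n. E w' i = E w i) \<longrightarrow> a \<le> c w'"
    and m: "(\<lambda>k. \<integral>\<^sup>+ w. c w \<partial>Q k) \<longlonglongrightarrow> m"
  shows "(\<integral>\<^sup>+ w. c w \<partial>P) \<le> m"
proof -
  define B where "B n h = E -` {f. history f n = h} \<inter> space M" for n h
  \<comment> \<open>The infimum over an empty block would be infinite; the value 0 keeps all
    coefficients finite, as needed to pass products to the limit.\<close>
  define g where "g n h = (if B n h = {} then 0 else INF w\<in>B n h. c w)" for n h
  define H where "H n = range (\<lambda>f :: nat \<Rightarrow> bool. history f n)" for n
  define cn where "cn n w = (\<Sum>h\<in>H n. g n h * indicator (B n h) w)" for n w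
  have B: "B n h \<in> sets M" for n h
    unfolding B_def by (rule measurable_sets[OF E sets_history_eq])
  have H: "finite (H n)" for n
    unfolding H_def by (rule finite_histories)
  have g_fin: "g n h < \<infinity>" for n h
  proof (cases "B n h = {}")
    case False
    then obtain w where w: "w \<in> B n h" by blast
    then have "(INF w\<in>B n h. c w) \<le> c w" by (rule INF_lower)
    also have "\<dots> < \<infinity>" using w by (intro fin) (auto simp: B_def)
    finally show ?thesis using False by (simp add: g_def)
  qed (simp add: g_def)
  have cn_eq: "cn n w = (INF w'\<in>{w'\<in>space M. \<forall>i<n. E w' i = E w i}. c w')" if w: "w \<in> space M" for n w
  proof -
    have ind: "indicator (B n h) w = (if h = history (E w) n then 1 else 0 :: ennreal)" for h
      using w by (auto simp: B_def indicator_def)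
    have "cn n w = (\<Sum>h\<in>H n. if history (E w) n = h then g n h else 0)"
      unfolding cn_def ind by (intro sum.cong) auto
    also have "\<dots> = g n (history (E w) n)"
      using H by (subst sum.delta') (auto simp: H_def)
    also have "B n (history (E w) n) = {w'\<in>space M. \<forall>i<n. E w' i = E w i}"
      by (auto simp: B_def history_eq_iff)
    then have "g n (history (E w) n) = (INF w'\<in>{w'\<in>space M. \<forall>i<n. E w' i = E w i}. c w')"
      using w by (auto simp: g_def)
    finally show ?thesis .
  qed
  have cn_le: "cn n w \<le> c w" if "w \<in> space M" for n w
    unfolding cn_eq[OF that] using that by (intro INF_lower) auto
  have cn_mono: "cn n w \<le> cn n' w" if "w \<in> space M" "n \<le> n'" for n n' w
    unfolding cn_eq[OF that(1)] using that(2) by (intro INF_superset_mono) auto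
  have cn_sup: "c w = (SUP n. cn n w)" if w: "w \<in> space M" for w
  proof (rule antisym)
    show "c w \<le> (SUP n. cn n w)"
    proof (rule dense_le)
      fix a assume "a < c w"
      from lsc[OF w this] obtain n where "\<forall>w'\<in>space M. (\<forall>i<n. E w' i = E w i) \<longrightarrow> a \<le> c w'" ..
      then have "a \<le> cn n w"
        unfolding cn_eq[OF w] by (intro INF_greatest) auto
      also have "\<dots> \<le> (SUP n. cn n w)" by (rule SUP_upper) simp
      finally show "a \<le> (SUP n. cn n w)" .
    qed
  qed (auto intro!: SUP_least cn_le w)
  have cn_int: "(\<integral>\<^sup>+ w. cn n w \<partial>R) = (\<Sum>h\<in>H n. g n h * ennreal (measure R (B n h)))"
    if R: "prob_space R" "sets R = sets M" for R n
  proof -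
    interpret prob_space R by (rule R)
    have B': "B n h \<in> sets R" for h using B R(2) by simp
    show ?thesis
      unfolding cn_def using B'
      by (subst nn_integral_sum) (auto simp: nn_integral_cmult_indicator emeasure_eq_measure)
  qed
  have cn_meas: "cn n \<in> borel_measurable P" for n
    using B P(2) unfolding cn_def by (intro borel_measurable_sum borel_measurable_times_ennreal
        borel_measurable_const borel_measurable_indicator) auto
  have spP: "space P = space M" and spQ: "space (Q k) = space M" for k
    using sets_eq_imp_space_eq[OF P(2)] sets_eq_imp_space_eq[OF Q(2)] by simp_all
  \<comment> \<open>For fixed \<open>n\<close> the integral is a finite combination of cylinder
    masses, so \<open>k\<close> tends to infinity first; monotone convergence in \<open>n\<close>
    follows.\<close>
  have cn_m: "(\<integral>\<^sup>+ w. cn n w \<partial>P) \<le> m" for n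
  proof (rule LIMSEQ_le[OF _ m])
    have "(\<lambda>k. measure (Q k) (B n h)) \<longlonglongrightarrow> measure P (B n h)" for h
      unfolding B_def by (rule lim[OF finitary_history_eq])
    then show "(\<lambda>k. \<integral>\<^sup>+ w. cn n w \<partial>Q k) \<longlonglongrightarrow> (\<integral>\<^sup>+ w. cn n w \<partial>P)"
      unfolding cn_int[OF P] cn_int[OF Q] using g_fin
      by (intro tendsto_sum ennreal_tendsto_cmult tendsto_ennrealI) auto
    show "\<exists>N. \<forall>k\<ge>N. (\<integral>\<^sup>+ w. cn n w \<partial>Q k) \<le> (\<integral>\<^sup>+ w. c w \<partial>Q k)"
      using cn_le by (auto intro!: nn_integral_mono simp: spQ)
  qed
  have "(\<integral>\<^sup>+ w. c w \<partial>P) = (\<integral>\<^sup>+ w. (SUP n. cn n w) \<partial>P)"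
    by (intro nn_integral_cong cn_sup) (simp add: spP)
  also have "\<dots> = (SUP n. \<integral>\<^sup>+ w. cn n w \<partial>P)"
    using cn_mono by (intro nn_integral_monotone_convergence_SUP_AE cn_meas AE_I2) (auto simp: spP)
  also have "\<dots> \<le> m"
    by (intro SUP_least cn_m)
  finally show ?thesis .
qed

text \<open>The direct method: a minimizing sequence has a limiting coupling, and lower
  semicontinuity bounds its cost by the infimum. The infimum may be infinite.\<close>

lemma ex_minimal_coupling:
  fixes M :: "'a measure" and N :: "'b measure" and c :: "'a \<times> 'b \<Rightarrow> ennreal"
  assumes M: "prob_space M" and N: "prob_space N"
    and e0: "e0 \<in> M \<rightarrow>\<^sub>M bit_space" and f0: "f0 \<in> bit_space \<rightarrow>\<^sub>M M"
    and fe0: "\<And>z. z \<in> space M \<Longrightarrow> f0 (e0 z) = z"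
    and e1: "e1 \<in> N \<rightarrow>\<^sub>M bit_space" and f1: "f1 \<in> bit_space \<rightarrow>\<^sub>M N"
    and fe1: "\<And>z. z \<in> space N \<Longrightarrow> f1 (e1 z) = z"
    and fin: "\<And>w. w \<in> space (M \<Otimes>\<^sub>M N) \<Longrightarrow> c w < \<infinity>"
    and lsc: "\<And>w a. w \<in> space (M \<Otimes>\<^sub>M N) \<Longrightarrow> a < c w \<Longrightarrow>
      \<exists>n. \<forall>w'\<in>space (M \<Otimes>\<^sub>M N).
        (\<forall>i<n. interleave e0 e1 w' i = interleave e0 e1 w i) \<longrightarrow> a \<le> c w'"
  shows "\<exists>\<rho>. is_arg_min (\<lambda>\<pi>. \<integral>\<^sup>+ w. c w \<partial>\<pi>) (\<lambda>\<pi>. \<pi> \<in> couplings M N) \<rho>"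
proof -
  let ?J = "\<lambda>\<pi>. \<integral>\<^sup>+ w. c w \<partial>\<pi>"
  define m where "m = Inf (?J ` couplings M N)"
  have "?J ` couplings M N \<noteq> {}"
    using pair_measure_coupling[OF M N] by blast
  from ennreal_Inf_countable_INF[OF this] obtain v :: "nat \<Rightarrow> ennreal" where
    v: "decseq v" "range v \<subseteq> ?J ` couplings M N" "m = (INF i. v i)"
    unfolding m_def by blast
  then have "\<forall>k. \<exists>\<pi>. \<pi> \<in> couplings M N \<and> ?J \<pi> = v k"
    by (metis (no_types, lifting) image_iff range_subsetD)
  then obtain \<pi> where \<pi>: "\<And>k. \<pi> k \<in> couplings M N" "\<And>k. ?J (\<pi> k) = v k"
    by metis
  have conv: "(\<lambda>k. ?J (\<pi> k)) \<longlonglongrightarrow> m"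
    unfolding \<pi>(2) v(3) by (rule LIMSEQ_INF[OF v(1)])
  obtain r \<rho> where r: "strict_mono r" and \<rho>: "\<rho> \<in> couplings M N"
    and lim: "\<And>n C. finitary n C \<Longrightarrow>
      (\<lambda>k. measure (\<pi> (r k)) (interleave e0 e1 -` C \<inter> space (M \<Otimes>\<^sub>M N)))
        \<longlonglongrightarrow> measure \<rho> (interleave e0 e1 -` C \<inter> space (M \<Otimes>\<^sub>M N))"
    using couplings_seq_compact[of e0 M f0 e1 N f1 \<pi>, OF e0 f0 fe0 e1 f1 fe1 \<pi>(1)] by blast
  have conv': "(\<lambda>k. ?J (\<pi> (r k))) \<longlonglongrightarrow> m"
    using LIMSEQ_subseq_LIMSEQ[OF conv r] by (simp add: o_def)
  have "?J \<rho> \<le> m"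
    by (rule nn_integral_le_of_finitary_limit[where Q = "\<lambda>k. \<pi> (r k)",
          OF measurable_interleave[OF e0 e1] couplingsD(1,2)[OF \<rho>]
          couplingsD(1,2)[OF \<pi>(1)] lim fin lsc conv'])
  moreover have "m \<le> ?J \<pi>'" if "\<pi>' \<in> couplings M N" for \<pi>'
    unfolding m_def by (rule Inf_lower) (rule imageI[OF that])
  ultimately show ?thesis
    using \<rho> by (intro exI[of _ \<rho>]) (auto simp: is_arg_min_def not_less intro: order_trans)
qed

section \<open>Optimal couplings\<close>

text \<open>Each bit records whether the point lies in one of the balls of radius \<open>1 / (m + 1)\<close> around a
  dense sequence. The point is recovered as the limit of the first centres that match.\<close>

lemma ex_bit_code:
  "\<exists>(e :: 'a::euclidean_space \<Rightarrow> nat \<Rightarrow> bool) f.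
    e \<in> borel \<rightarrow>\<^sub>M bit_space \<and> f \<in> bit_space \<rightarrow>\<^sub>M borel \<and> (\<forall>z. f (e z) = z) \<and>
    (\<forall>z. \<forall>r>0. \<exists>n. \<forall>z'. (\<forall>i<n. e z' i = e z i) \<longrightarrow> dist z' z < r)"
proof -
  obtain S :: "'a set" where S: "countable S" "\<And>X. open X \<Longrightarrow> X \<noteq> {} \<Longrightarrow> \<exists>d\<in>S. d \<in> X"
    using countable_dense_exists by blast
  then have "S \<noteq> {}"
    by (metis UNIV_not_empty empty_iff open_UNIV)
  define d where "d = from_nat_into S"
  have dense: "\<exists>i. dist z (d i) < r" if "r > 0" for z r
  proof -
    obtain s where "s \<in> S" "s \<in> ball z r"
      using S(2)[of "ball z r"] \<open>r > 0\<close> by auto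
    then show ?thesis
      using from_nat_into_surj[OF S(1)] unfolding d_def by (metis mem_ball)
  qed
  define e where
    "e z k = (dist z (d (fst (prod_decode k))) < 1 / (real (snd (prod_decode k)) + 1))" for z k
  \<comment> \<open>The first matching centre at scale \<open>m\<close>. On sequences that are not
    codes, \<open>LEAST\<close> and \<open>lim\<close> may take arbitrary values; \<open>f\<close>
    remains measurable.\<close>
  define L where "L b m = (LEAST i. b (prod_encode (i, m)))" for b :: "nat \<Rightarrow> bool" and m
  define f where "f b = lim (\<lambda>m. d (L b m))" for b
  have "(\<lambda>z. e z k) \<in> borel \<rightarrow>\<^sub>M count_space UNIV" for k
    unfolding e_def by measurable
  then have e: "e \<in> borel \<rightarrow>\<^sub>M bit_space"
    by (rule measurable_bit_spaceI)
  have "(\<lambda>b. L b m) \<in> bit_space \<rightarrow>\<^sub>M count_space UNIV" for m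
    unfolding L_def by (rule measurable_Least) (rule measurable_bit)
  then have "(\<lambda>b. d (L b m)) \<in> bit_space \<rightarrow>\<^sub>M borel" for m
    by (rule measurable_compose) simp
  then have f: "f \<in> bit_space \<rightarrow>\<^sub>M borel"
    unfolding f_def by (rule borel_measurable_lim_metric)
  have close: "dist z (d (L (e z) m)) < 1 / (real m + 1)" for z m
  proof -
    obtain i where "dist z (d i) < 1 / (real m + 1)"
      using dense[of "1 / (real m + 1)" z] by auto
    then have "e z (prod_encode (i, m))"
      by (simp add: e_def)
    then have "e z (prod_encode (L (e z) m, m))"
      unfolding L_def by (rule LeastI)
    then show ?thesis by (simp add: e_def)
  qed
  have "f (e z) = z" for z
  proof -
    have "(\<lambda>m. dist (d (L (e z) m)) z) \<longlonglongrightarrow> 0"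
    proof (rule tendsto_sandwich[OF _ _ tendsto_const LIMSEQ_inverse_real_of_nat])
      show "\<forall>\<^sub>F m in sequentially. dist (d (L (e z) m)) z \<le> inverse (real (Suc m))"
        using close[of z] by (intro always_eventually allI less_imp_le)
          (simp add: dist_commute inverse_eq_divide add.commute)
    qed simp
    then have "(\<lambda>m. d (L (e z) m)) \<longlonglongrightarrow> z"
      by (rule iffD2[OF tendsto_dist_iff])
    then show ?thesis
      unfolding f_def by (rule limI)
  qed
  \<comment> \<open>One bit suffices: it places both points in the same small ball. The bound is the
    successor of its position so that this bit is included.\<close>
  moreover have "\<exists>n. \<forall>z'. (\<forall>i<n. e z' i = e z i) \<longrightarrow> dist z' z < r" if "r > 0" for z r
  proof -
    obtain m where m: "1 / (real m + 1) < r / 2"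
      using reals_Archimedean[of "r / 2"] \<open>r > 0\<close> by (auto simp: inverse_eq_divide add.commute)
    let ?k = "prod_encode (L (e z) m, m)"
    have "dist z' z < r" if "\<forall>i<Suc ?k. e z' i = e z i" for z'
    proof -
      have "e z ?k" using close[of z m] by (simp add: e_def)
      with that have "e z' ?k" by simp
      then have "dist z' (d (L (e z) m)) < 1 / (real m + 1)" by (simp add: e_def)
      with close[of z m] m show ?thesis
        using dist_triangle2[of z' z "d (L (e z) m)"] by linarith
    qed
    then show ?thesis by blast
  qed
  ultimately show ?thesis
    using e f by blast
qed

text \<open>Codes determine points up to small distance, so a continuous cost is lower
  semicontinuous in the code. The ambient code is used on \<open>A\<close>, with decoded points
  outside \<open>A\<close> sent to a fixed \<open>a\<close> in \<open>A\<close>.\<close>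

lemma ex_optimal_coupling_continuous_cost:
  fixes M N :: "'a::euclidean_space measure" and c :: "'a \<times> 'a \<Rightarrow> real"
  assumes A: "A \<in> sets borel" and M: "M \<in> probs_on A" and N: "N \<in> probs_on A"
    and c: "continuous_on UNIV c"
  shows "\<exists>\<rho>. is_arg_min (\<lambda>\<pi>. \<integral>\<^sup>+ w. ennreal (c w) \<partial>\<pi>) (\<lambda>\<pi>. \<pi> \<in> couplings M N) \<rho>"
proof -
  have M: "prob_space M" "sets M = sets (restrict_space borel A)"
    and N: "prob_space N" "sets N = sets (restrict_space borel A)"
    using M N by (auto simp: probs_on_def)
  have spM: "space M = A" and spN: "space N = A"
    using sets_eq_imp_space_eq[OF M(2)] sets_eq_imp_space_eq[OF N(2)]
    by (simp_all add: space_restrict_space)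
  obtain a where a: "a \<in> A"
    using prob_space.not_empty[OF M(1)] spM by blast
  obtain e :: "'a \<Rightarrow> nat \<Rightarrow> bool" and g where e: "e \<in> borel \<rightarrow>\<^sub>M bit_space"
    and g: "g \<in> bit_space \<rightarrow>\<^sub>M borel" and ge: "\<And>z. g (e z) = z"
    and sep: "\<And>z r. r > 0 \<Longrightarrow> \<exists>n. \<forall>z'. (\<forall>i<n. e z' i = e z i) \<longrightarrow> dist z' z < r"
    using ex_bit_code[where 'a = 'a] by (elim exE conjE) simp
  define f where "f b = (if g b \<in> A then g b else a)" for b
  have "f \<in> bit_space \<rightarrow>\<^sub>M borel"
    unfolding f_def using g A by measurable
  then have f: "f \<in> bit_space \<rightarrow>\<^sub>M restrict_space borel A"
    using a by (intro measurable_restrict_space2) (auto simp: f_def)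
  have eA: "e \<in> restrict_space borel A \<rightarrow>\<^sub>M bit_space"
    using e by (rule measurable_restrict_space1)
  have fe: "f (e z) = z" if "z \<in> A" for z
    using that by (simp add: f_def ge)
  show ?thesis
  proof (rule ex_minimal_coupling[OF M(1) N(1), of e f e f])
    show "e \<in> M \<rightarrow>\<^sub>M bit_space" "e \<in> N \<rightarrow>\<^sub>M bit_space"
      using eA measurable_cong_sets[OF M(2) refl] measurable_cong_sets[OF N(2) refl] by blast+
    show "f \<in> bit_space \<rightarrow>\<^sub>M M" "f \<in> bit_space \<rightarrow>\<^sub>M N"
      using f measurable_cong_sets[OF refl M(2)] measurable_cong_sets[OF refl N(2)] by blast+
    show "f (e z) = z" if "z \<in> space M" for z using fe that spM by simp
    show "f (e z) = z" if "z \<in> space N" for z using fe that spN by simp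
    show "ennreal (c w) < \<infinity>" for w by simp
    fix w :: "'a \<times> 'a" and b assume b: "b < ennreal (c w)"
    have "open ((\<lambda>w. ennreal (c w)) -` {b<..})"
      by (intro open_vimage continuous_on_ennreal c) simp
    moreover have "w \<in> (\<lambda>w. ennreal (c w)) -` {b<..}"
      using b by simp
    ultimately have "\<exists>r>0. \<forall>w'. dist w' w < r \<longrightarrow> w' \<in> (\<lambda>w. ennreal (c w)) -` {b<..}"
      unfolding open_dist by (rule bspec)
    then obtain r where r: "r > 0" and ball: "\<And>w'. dist w' w < r \<Longrightarrow> b < ennreal (c w')"
      by auto
    obtain n0 where n0: "\<And>z'. (\<forall>i<n0. e z' i = e (fst w) i) \<Longrightarrow> dist z' (fst w) < r / 2"
      using sep[of "r / 2" "fst w"] r by auto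
    obtain n1 where n1: "\<And>z'. (\<forall>i<n1. e z' i = e (snd w) i) \<Longrightarrow> dist z' (snd w) < r / 2"
      using sep[of "r / 2" "snd w"] r by auto
    \<comment> \<open>The first \<open>2 * (n0 + n1)\<close> interleaved bits contain the first
      \<open>n0\<close> bits of one component and the first \<open>n1\<close> of the other.\<close>
    have "b \<le> ennreal (c w')"
      if eq: "\<forall>i<2 * (n0 + n1). interleave e e w' i = interleave e e w i" for w'
    proof -
      have "e (fst w') i = e (fst w) i" if "i < n0" for i
        using eq[rule_format, of "2 * i"] that by (simp add: interleave_def)
      then have d0: "dist (fst w') (fst w) < r / 2" by (intro n0) simp
      have "e (snd w') i = e (snd w) i" if "i < n1" for i
        using eq[rule_format, of "2 * i + 1"] that by (simp add: interleave_def)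
      then have d1: "dist (snd w') (snd w) < r / 2" by (intro n1) simp
      have "dist w' w \<le> dist (fst w') (fst w) + dist (snd w') (snd w)"
        unfolding dist_prod_def by (rule sqrt_sum_squares_le_sum) auto
      with d0 d1 show ?thesis
        by (intro less_imp_le ball) linarith
    qed
    then show "\<exists>n. \<forall>w'\<in>space (M \<Otimes>\<^sub>M N). (\<forall>i<n. interleave e e w' i = interleave e e w i) \<longrightarrow>
        b \<le> ennreal (c w')"
      by blast
  qed
qed

theorem theorem2:
  fixes X V :: "(real ^ 'd) set"
    and \<mu>0 \<mu>1 :: "((real ^ 'd) \<times> (real ^ 'd)) measure"
  assumes "X \<in> sets borel" and "V \<in> sets borel"
    and "\<mu>0 \<in> probs_on (X \<times> V)" and "\<mu>1 \<in> probs_on (X \<times> V)"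
  shows "(\<exists>\<pi>. optimal_coupling 1 \<mu>0 \<mu>1 \<pi>) \<and>
    (\<forall>\<pi>. optimal_coupling 1 \<mu>0 \<mu>1 \<pi> \<longrightarrow>
      (\<forall>x0 v0 x1 v1. ((x0, v0), (x1, v1)) \<in> measure_support \<pi> \<longrightarrow>
        (straight (trajectory (x0, v0) (x1, v1)) \<longleftrightarrow> collinear {0, x1 - x0, v0, v1}) \<and>
        (\<not> collinear {0, x1 - x0, v0, v1} \<longrightarrow>
          bends_to_match_orth (x0, v0) (x1, v1) (trajectory (x0, v0) (x1, v1)))))"
proof -
  \<comment> \<open>Phase space is itself Euclidean, so the existence lemma applies with
    \<open>A = X \<times> V\<close>.\<close>
  have "X \<times> V \<in> sets borel"
    using assms(1,2) by (simp flip: borel_prod)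
  moreover have "continuous_on UNIV (\<lambda>w :: ((real ^ 'd) \<times> (real ^ 'd)) \<times> ((real ^ 'd) \<times> (real ^ 'd)).
      oat_cost 1 (fst w) (snd w))"
    unfolding oat_cost_def case_prod_beta by (intro continuous_intros)
  ultimately have "\<exists>\<pi>. optimal_coupling 1 \<mu>0 \<mu>1 \<pi>"
    using ex_optimal_coupling_continuous_cost[OF _ assms(3,4)]
    unfolding optimal_coupling_def oat_objective_def case_prod_beta by blast
  then show ?thesis
    using straight_trajectory_iff trajectory_bends_to_match_orth by blast
qed

end
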